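(* $\mathrm{ord}(\mathcal{K}_1) = \omega_1^{CK}$, where $\omega_1^{CK}$ is the least non-computable ordinal.
   Context: A partial applicative structure is a set $\mathcal{A}$ with a partial binary operation (application) $(a,b)\mapsto ab$; application associates to the left. Closed terms over $\mathcal{A}$ are built from elements of $\mathcal{A}$ by application; a closed term is defined if all its subterms are defined. For closed terms, $s \simeq t$ (Kleene equality) means either both are undefined, or both are defined with the same value. $\mathcal{A}$ is a partial combinatory algebra (pca) if there are $K,S\in\mathcal{A}$ with $Kab$ defined and equal to $a$, and $Sab$ defined and $Sabc \simeq ac(bc)$, for all $a,b,c$. For a pca $\mathcal{A}$ define relations $\sim_\alpha$ on closed terms for all ordinals $\alpha$: $s\sim_0 t$ iff $s\simeq t$; $s \sim_{\alpha+1} t$ iff $sx \sim_\alpha tx$ for all $x\in\mathcal{A}$; for limit $\alpha$, $s\sim_\alpha t$ iff $s\sim_\beta t$ for some $\beta<\alpha$. $\mathrm{ord}(\mathcal{A})$ is the least ordinal $\alpha$ such that $\sim_\alpha$ and $\sim_{\alpha+1}$ are the same relation. Kleene's first model $\mathcal{K}_1$ is the pca with underlying set $\omega$ and application $n\cdot m = \Phi_n(m)$, where $\Phi_n$ is the $n$-th partial computable function. *)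

theory Defs
  imports "HOL-Library.Nat_Bijection" "HOL-Library.Infinite_Typeclass"
begin

unbundle cardinal_syntax

section \<open>Ordinals\<close>

text \<open>
  An ordinal is an isomorphism class of reflexive well-orders on subsets of \<^typ>\<open>'b\<close>.
  For infinite \<^typ>\<open>'b\<close> these are exactly the ordinals below the cardinal successor of
  the cardinality of \<^typ>\<open>'b\<close>.
\<close>

quotient_type 'b ordinal = "'b rel" / partial: "\<lambda>r s. r =o s"
proof (rule part_equivpI)
  show "\<exists>r :: 'b rel. r =o r"
    by (rule exI[of _ "{}"], rule ordIso_reflexive) simp
  show "symp (\<lambda>r s :: 'b rel. r =o s)"
    by (auto intro: sympI ordIso_symmetric)
  show "transp (\<lambda>r s :: 'b rel. r =o s)"
    by (auto intro: transpI ordIso_transitive)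
qed

lemma ordinal_cases:
  obtains r where "r =o r" "\<alpha> = abs_ordinal r"
  using Quotient3_rep_reflp[OF Quotient3_ordinal] Quotient3_abs_rep[OF Quotient3_ordinal] that
  by metis

instantiation ordinal :: (type) wellorder
begin

lift_definition less_eq_ordinal :: "'b ordinal \<Rightarrow> 'b ordinal \<Rightarrow> bool" is "\<lambda>r s. r \<le>o s"
  by (meson ordIso_imp_ordLeq ordIso_symmetric ordLeq_transitive)

lift_definition less_ordinal :: "'b ordinal \<Rightarrow> 'b ordinal \<Rightarrow> bool" is "\<lambda>r s. r <o s"
  by (meson ordIso_symmetric ordIso_ordLess_trans ordLess_ordIso_trans)

instance
proof
  fix x y z :: "'a ordinal"
  show "x < y \<longleftrightarrow> x \<le> y \<and> \<not> y \<le> x"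
    by transfer (metis not_ordLess_ordLeq ordIso_iff_ordLeq ordLeq_iff_ordLess_or_ordIso)
  show "x \<le> x"
    by transfer (simp add: ordIso_imp_ordLeq)
  show "x \<le> y \<Longrightarrow> y \<le> z \<Longrightarrow> x \<le> z"
    by transfer (rule ordLeq_transitive)
  show "x \<le> y \<Longrightarrow> y \<le> x \<Longrightarrow> x = y"
    by transfer (simp add: ordIso_iff_ordLeq)
  show "x \<le> y \<or> y \<le> x"
    by transfer (metis ordLeq_total ordIso_iff_ordLeq ordLeq_Well_order_simp)
next
  fix P :: "'a ordinal \<Rightarrow> bool" and a
  assume step: "\<And>x. (\<And>y. y < x \<Longrightarrow> P y) \<Longrightarrow> P x"
  have "P (abs_ordinal r)" if "r =o r" for r
    using wf_ordLess that
  proof (induction r rule: wf_induct_rule)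
    case (less r)
    show ?case
    proof (rule step)
      fix y assume y: "y < abs_ordinal r"
      obtain s where s: "s =o s" "y = abs_ordinal s"
        by (rule ordinal_cases)
      have "s <o r"
        using y s less.prems by (simp add: less_ordinal.abs_eq)
      then show "P y"
        using less.IH s by simp
    qed
  qed
  then show "P a"
    by (metis ordinal_cases)
qed

end

lemma ordinal_no_top: "\<exists>\<beta>. \<alpha> < (\<beta> :: 'b :: infinite ordinal)"
proof transfer
  fix r :: "'b rel"
  assume r: "r =o r"
  then have wo: "Well_order r"
    by (simp add: ordIso_def)
  obtain c :: 'b and f :: "'b \<Rightarrow> 'b" where f: "inj f" "c \<notin> range f"
  proof -
    obtain g :: "nat \<Rightarrow> 'b" where g: "inj g"
      using arb_countable_map[of "{} :: 'b set"] by auto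
    define f where "f x = (if x \<in> range g then g (Suc (inv g x)) else x)" for x
    have fg: "f (g n) = g (Suc n)" for n
      using g by (simp add: f_def)
    have "inj f"
    proof (rule injI)
      fix x y assume "f x = f y"
      then show "x = y"
        using g by (auto simp: f_def inj_eq split: if_splits)
    qed
    moreover have "g 0 \<notin> range f"
      using g by (auto simp: f_def inj_eq split: if_splits)
    ultimately show ?thesis
      using that by blast
  qed
  define q where "q = dir_image r f"
  define s where "s = q \<union> (Field q \<times> {c}) \<union> {(c, c)}"
  have q: "Well_order q" "r =o q"
    using wo f(1) by (auto simp: q_def intro: Well_order_dir_image dir_image_ordIso inj_on_subset)
  have c: "c \<notin> Field q"
    using f(2) by (auto simp: q_def dir_image_Field)
  have cq: "(c, x) \<notin> q" "(x, c) \<notin> q" for x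
    using c by (auto simp: Field_def)
  have Fs: "Field s = insert c (Field q)"
    by (auto simp: s_def Field_def)
  have qF: "x \<in> Field q \<and> y \<in> Field q" if "(x, y) \<in> q" for x y
    using that by (auto simp: Field_def)
  have ord: "Refl q" "trans q" "antisym q" "Total q" "wf (q - Id)"
    using q(1) by (auto simp: order_on_defs well_order_on_def)
  have "Refl s"
    using ord(1) unfolding refl_on_def Fs by (auto simp: s_def)
  moreover have "trans s"
    using ord(2) cq unfolding s_def trans_def by (blast dest: qF)
  moreover have "antisym s"
    using ord(3) cq c by (auto simp: s_def antisym_def dest: qF)
  moreover have "Total s"
    using ord(4) unfolding total_on_def Fs by (auto simp: s_def)
  moreover have "wf (s - Id)"
    unfolding wf_eq_minimal
  proof (intro allI impI)
    fix Q :: "'b set" and x assume x: "x \<in> Q"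
    show "\<exists>z\<in>Q. \<forall>y. (y, z) \<in> s - Id \<longrightarrow> y \<notin> Q"
    proof (cases "\<exists>z. z \<in> Q \<inter> Field q")
      case True
      then obtain z where "z \<in> Q \<inter> Field q" "\<forall>y. (y, z) \<in> q - Id \<longrightarrow> y \<notin> Q \<inter> Field q"
        using ord(5) unfolding wf_eq_minimal by meson
      then show ?thesis
        using c by (intro bexI[of _ z]) (auto simp: s_def dest: qF)
    next
      case False
      then have "\<forall>y. (y, x) \<in> s - Id \<longrightarrow> y \<notin> Q"
        by (auto simp: s_def dest: qF)
      then show ?thesis
        using x by blast
    qed
  qed
  ultimately have s: "Well_order s"
    by (auto simp: well_order_on_def linear_order_on_def partial_order_on_def preorder_on_def
        intro: FieldI1 FieldI2)
  have us: "underS s c = Field q"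
    using c cq by (auto simp: underS_def s_def)
  have "Restr s (underS s c) = q"
    unfolding us using c by (auto simp: s_def dest: qF)
  then have "q <o s"
    using ordLess_iff_ordIso_Restr[OF s q(1)] ordIso_reflexive[OF q(1)] Fs by auto
  then have rs: "r <o s"
    using q(2) ordIso_ordLess_trans by blast
  show "\<exists>\<beta> :: 'b rel \<in> {\<beta>. \<beta> =o \<beta>}. r <o \<beta>"
    by (rule bexI[of _ s]) (simp_all add: rs ordIso_reflexive[OF s])
qed

definition ozero :: "'b ordinal" where
  "ozero = (LEAST \<alpha>. True)"

definition osucc :: "'b ordinal \<Rightarrow> 'b ordinal" where
  "osucc \<alpha> = (LEAST \<beta>. \<alpha> < \<beta>)"

definition is_limit :: "'b ordinal \<Rightarrow> bool" where
  "is_limit \<alpha> \<longleftrightarrow> \<alpha> \<noteq> ozero \<and> (\<forall>\<beta>. \<alpha> \<noteq> osucc \<beta>)"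

lemma ozero_le: "ozero \<le> \<alpha>"
  unfolding ozero_def by (rule Least_le) simp

lemma less_osucc: "\<alpha> < osucc (\<alpha> :: 'b :: infinite ordinal)"
  unfolding osucc_def using ordinal_no_top by (rule LeastI_ex)

lemma osucc_le: "\<alpha> < \<beta> \<Longrightarrow> osucc \<alpha> \<le> \<beta>"
  unfolding osucc_def by (rule Least_le)

lemma osucc_inject: "osucc \<alpha> = osucc \<beta> \<longleftrightarrow> \<alpha> = (\<beta> :: 'b :: infinite ordinal)"
  by (metis less_osucc osucc_le leD linorder_neqE)

lemma osucc_neq_ozero: "osucc \<alpha> \<noteq> (ozero :: 'b :: infinite ordinal)"
  by (metis less_osucc ozero_le leD)

section \<open>Closed terms over a partial applicative structure\<close>

datatype 'a cterm = Elem 'a | App "'a cterm" "'a cterm"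

text \<open>
  A partial applicative structure on \<^typ>\<open>'a\<close> is its application
  \<^typ>\<open>'a \<Rightarrow> 'a \<Rightarrow> 'a option\<close>; \<^term>\<open>None\<close> means undefined.
\<close>

primrec val :: "('a \<Rightarrow> 'a \<Rightarrow> 'a option) \<Rightarrow> 'a cterm \<Rightarrow> 'a option" where
  "val ap (Elem a) = Some a"
| "val ap (App s t) =
    (case (val ap s, val ap t) of (Some a, Some b) \<Rightarrow> ap a b | _ \<Rightarrow> None)"

definition kleene_eq :: "('a \<Rightarrow> 'a \<Rightarrow> 'a option) \<Rightarrow> 'a cterm \<Rightarrow> 'a cterm \<Rightarrow> bool" where
  "kleene_eq ap s t \<longleftrightarrow> val ap s = val ap t"

text \<open>
  The three clauses are in fact equivalences, see the lemmas below. The ordinals range over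
  \<^typ>\<open>'b ordinal\<close> for an infinite type \<^typ>\<open>'b\<close> unrelated to \<^typ>\<open>'a\<close>
  (for finite \<^typ>\<open>'b\<close> there would be a largest ordinal, without successor).
\<close>

inductive sim :: "('a \<Rightarrow> 'a \<Rightarrow> 'a option) \<Rightarrow> 'b :: infinite ordinal \<Rightarrow> 'a cterm \<Rightarrow> 'a cterm \<Rightarrow> bool"
  for ap :: "'a \<Rightarrow> 'a \<Rightarrow> 'a option" where
  sim_zeroI: "kleene_eq ap s t \<Longrightarrow> sim ap ozero s t"
| sim_succI: "(\<And>x. sim ap \<alpha> (App s (Elem x)) (App t (Elem x))) \<Longrightarrow> sim ap (osucc \<alpha>) s t"
| sim_limitI: "is_limit \<alpha> \<Longrightarrow> \<beta> < \<alpha> \<Longrightarrow> sim ap \<beta> s t \<Longrightarrow> sim ap \<alpha> s t"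

lemma sim_ozero: "sim ap ozero s t \<longleftrightarrow> kleene_eq ap s t"
  by (subst sim.simps) (auto simp: is_limit_def osucc_neq_ozero[symmetric])

lemma sim_osucc: "sim ap (osucc \<alpha>) s t \<longleftrightarrow> (\<forall>x. sim ap \<alpha> (App s (Elem x)) (App t (Elem x)))"
  by (subst sim.simps) (auto simp: is_limit_def osucc_inject osucc_neq_ozero)

lemma sim_limit: "is_limit \<alpha> \<Longrightarrow> sim ap \<alpha> s t \<longleftrightarrow> (\<exists>\<beta><\<alpha>. sim ap \<beta> s t)"
  by (subst sim.simps) (auto simp: is_limit_def)

text \<open>
  The relations increase with the ordinal, so some ordinal as below exists in
  \<^typ>\<open>'b ordinal\<close> as soon as \<^typ>\<open>'b\<close> is infinite and at least as large as
  \<^typ>\<open>'a\<close>; its value then does not depend on \<^typ>\<open>'b\<close>. In particular every infinite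
  \<^typ>\<open>'b\<close> will do for a countable structure.
\<close>

definition pca_ord :: "('a \<Rightarrow> 'a \<Rightarrow> 'a option) \<Rightarrow> 'b :: infinite ordinal" where
  "pca_ord ap = (LEAST \<alpha>. sim ap \<alpha> = sim ap (osucc \<alpha>))"

section \<open>Partial computable functions and Kleene's first model\<close>

text \<open>
  Partial recursive functions on the natural numbers in one argument, where tuples of
  arguments are coded by the Cantor pairing \<^term>\<open>prod_encode\<close>. \<open>Prec\<close> is primitive
  recursion with one parameter, \<open>Mu\<close> is unbounded minimisation (all smaller arguments must
  give defined, nonzero values).
\<close>

datatype code =
    Zero
  | Succ
  | Left
  | Right
  | Pair code code
  | Comp code code
  | Prec code code
  | Mu code

primrec eval :: "code \<Rightarrow> nat \<Rightarrow> nat option" where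
  "eval Zero x = Some 0"
| "eval Succ x = Some (Suc x)"
| "eval Left x = Some (fst (prod_decode x))"
| "eval Right x = Some (snd (prod_decode x))"
| "eval (Pair f g) x =
    Option.bind (eval f x) (\<lambda>a. Option.bind (eval g x) (\<lambda>b. Some (prod_encode (a, b))))"
| "eval (Comp f g) x = Option.bind (eval g x) (eval f)"
| "eval (Prec f g) x =
    (case prod_decode x of (a, n) \<Rightarrow>
      rec_nat (eval f a)
        (\<lambda>k r. Option.bind r (\<lambda>v. eval g (prod_encode (a, prod_encode (k, v))))) n)"
| "eval (Mu f) x =
    (if \<exists>n. eval f (prod_encode (x, n)) = Some 0 \<and>
          (\<forall>m<n. \<exists>v. eval f (prod_encode (x, m)) = Some (Suc v))
     then Some (LEAST n. eval f (prod_encode (x, n)) = Some 0)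
     else None)"

primrec index :: "code \<Rightarrow> nat" where
  "index Zero = 0"
| "index Succ = 1"
| "index Left = 2"
| "index Right = 3"
| "index (Pair f g) = 4 + 4 * prod_encode (index f, index g)"
| "index (Comp f g) = 5 + 4 * prod_encode (index f, index g)"
| "index (Prec f g) = 6 + 4 * prod_encode (index f, index g)"
| "index (Mu f) = 7 + 4 * index f"

lemma inj_index: "inj index"
proof (rule injI)
  fix c d :: code
  assume "index c = index d"
  then show "c = d"
  proof (induction c arbitrary: d)
    case (Pair f g)
    then show ?case by (cases d) (simp_all, presburger+)
  next
    case (Comp f g)
    then show ?case by (cases d) (simp_all, presburger+)
  next
    case (Prec f g)
    then show ?case by (cases d) (simp_all, presburger+)
  next
    case (Mu f)
    then show ?case by (cases d) (simp_all, presburger+)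
  qed (case_tac d; simp)+
qed

lemma surj_index: "\<exists>c. index c = n"
proof (induction n rule: less_induct)
  case (less n)
  show ?case
  proof (cases "n < 4")
    case True
    then have "n = 0 \<or> n = 1 \<or> n = 2 \<or> n = 3"
      by auto
    then show ?thesis
      by (metis index.simps(1-4))
  next
    case False
    define k where "k = (n - 4) div 4"
    obtain a b where ab: "k = prod_encode (a, b)"
      by (metis prod_decode_inverse surj_pair)
    have k: "k < n"
      using False by (simp add: k_def)
    then have "a < n" "b < n"
      using le_prod_encode_1[of a b] le_prod_encode_2[of b a] by (auto simp: ab)
    then obtain c d e where cde: "index c = a" "index d = b" "index e = k"
      using less.IH k by blast
    have "n = 4 + 4 * k \<or> n = 5 + 4 * k \<or> n = 6 + 4 * k \<or> n = 7 + 4 * k"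
      using False unfolding k_def by presburger
    then show ?thesis
      using cde ab by (metis index.simps(5-8))
  qed
qed

lemma bij_index: "bij index"
  using inj_index surj_index by (metis bijI surjI surj_def)

definition Phi :: "nat \<Rightarrow> nat \<Rightarrow> nat option" where
  "Phi n = eval (inv index n)"

definition kleene1 :: "nat \<Rightarrow> nat \<Rightarrow> nat option" where
  "kleene1 n m = Phi n m"

section \<open>Computable ordinals\<close>

definition computable_rel :: "nat rel \<Rightarrow> bool" where
  "computable_rel r \<longleftrightarrow>
    (\<exists>e. \<forall>x y. Phi e (prod_encode (x, y)) = Some (if (x, y) \<in> r then 1 else 0))"

text \<open>
  Since \<^term>\<open>r\<close> is reflexive on its field, computability of \<^term>\<open>r\<close> includes that
  of its field.
\<close>

lift_definition computable_ordinal :: "'b ordinal \<Rightarrow> bool" is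
  "\<lambda>s. \<exists>r :: nat rel. computable_rel r \<and> r =o s"
  by (meson ordIso_symmetric ordIso_transitive)

text \<open>
  There are only countably many computable ordinals, and \<^typ>\<open>'b ordinal\<close> is uncountable for
  infinite \<^typ>\<open>'b\<close>, so a non-computable one exists.
\<close>

definition omega1_CK :: "'b :: infinite ordinal" where
  "omega1_CK = (LEAST \<alpha>. \<not> computable_ordinal \<alpha>)"

end

theory Submission
  imports Defs
begin

text \<open>
  Call the least \<open>\<alpha>\<close> with \<open>s \<sim>\<^sub>\<alpha> t\<close> the rank of the pair \<open>(s, t)\<close>.
  For the lower bound, given a computable well-order, the recursion theorem yields pairwise
  distinct programs \<open>f\<^sub>x\<close>, \<open>g\<^sub>x\<close> such that \<open>f\<^sub>x\<close> maps \<open>y\<close> to \<open>f\<^sub>y\<close> and \<open>g\<^sub>x\<close> maps \<open>y\<close> to \<open>g\<^sub>y\<close>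
  if \<open>y\<close> precedes \<open>x\<close>, and both map \<open>y\<close> to \<open>0\<close> otherwise; the rank of \<open>(f\<^sub>x, g\<^sub>x)\<close> is the
  successor of the ordinal of \<open>x\<close>.
  For the upper bound, the pairs reachable from a pair with a rank by applying both sides to
  the same argument, stopping at equal values, form a well-founded tree. With witnesses of
  convergence added to its nodes, its edges become \<open>\<Pi>\<^sub>1\<close>, so it embeds into a decidable
  well-founded tree, whose Kleene-Brouwer order is a computable well-order above the rank.
\<close>

section \<open>Closure properties of computable functions\<close>

definition computable :: "(nat \<Rightarrow> nat) \<Rightarrow> bool" where
  "computable f \<longleftrightarrow> (\<exists>c. \<forall>x. eval c x = Some (f x))"

definition decidable :: "(nat \<Rightarrow> bool) \<Rightarrow> bool" where
  "decidable P \<longleftrightarrow> computable (\<lambda>x. if P x then 1 else 0)"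

abbreviation (input) dfst :: "nat \<Rightarrow> nat" where "dfst p \<equiv> fst (prod_decode p)"
abbreviation (input) dsnd :: "nat \<Rightarrow> nat" where "dsnd p \<equiv> snd (prod_decode p)"

lemma computable_id: "computable (\<lambda>x. x)"
  unfolding computable_def by (rule exI[of _ "code.Pair Left Right"]) simp

lemma computable_compose: "computable f \<Longrightarrow> computable g \<Longrightarrow> computable (\<lambda>x. f (g x))"
  unfolding computable_def by (metis bind.bind_lunit eval.simps(6))

lemma computable_Suc: "computable f \<Longrightarrow> computable (\<lambda>x. Suc (f x))"
  by (rule computable_compose) (auto simp: computable_def intro: exI[of _ Succ])

lemma computable_dfst: "computable f \<Longrightarrow> computable (\<lambda>x. fst (prod_decode (f x)))"
  by (rule computable_compose[of "\<lambda>x. fst (prod_decode x)"])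
    (auto simp: computable_def intro: exI[of _ Left])

lemma computable_dsnd: "computable f \<Longrightarrow> computable (\<lambda>x. snd (prod_decode (f x)))"
  by (rule computable_compose[of "\<lambda>x. snd (prod_decode x)"])
    (auto simp: computable_def intro: exI[of _ Right])

lemma computable_const: "computable (\<lambda>x. k)"
proof (induction k)
  case 0
  show ?case
    unfolding computable_def by (rule exI[of _ Zero]) simp
qed (rule computable_Suc)

lemma computable_prod_encode:
  assumes "computable f" "computable g"
  shows "computable (\<lambda>x. prod_encode (f x, g x))"
proof -
  obtain c d where "\<And>x. eval c x = Some (f x)" "\<And>x. eval d x = Some (g x)"
    using assms unfolding computable_def by metis
  then show ?thesis
    unfolding computable_def by (intro exI[of _ "code.Pair c d"]) simp
qed

text \<open>The parameter of \<open>Prec\<close> carries the whole input \<open>x\<close>, so start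
  value and step may both depend on it. The third premise uncurries the step function in the
  argument format of \<open>Prec\<close>.\<close>

lemma computable_rec_nat:
  assumes "computable a" "computable n"
    and "computable (\<lambda>p. g (dfst p) (dfst (dsnd p)) (dsnd (dsnd p)))"
  shows "computable (\<lambda>x. rec_nat (a x) (g x) (n x))"
proof -
  obtain c d where c: "\<And>x. eval c x = Some (a x)"
    and d: "\<And>p. eval d p = Some (g (dfst p) (dfst (dsnd p)) (dsnd (dsnd p)))"
    using assms(1,3) unfolding computable_def by metis
  have "eval (Prec c d) (prod_encode (x, k)) = Some (rec_nat (a x) (g x) k)" for x k
    by (induction k) (simp_all add: c d)
  then have "computable (\<lambda>p. rec_nat (a (dfst p)) (g (dfst p)) (dsnd p))"
    unfolding computable_def by (metis prod.collapse prod_decode_inverse)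
  from computable_compose[OF this computable_prod_encode[OF computable_id assms(2)]]
  show ?thesis
    by simp
qed

named_theorems comp

lemmas [comp] = computable_id computable_const computable_Suc computable_dfst computable_dsnd
  computable_prod_encode

section \<open>Arithmetic, case distinction and decidable predicates\<close>

lemma computable_add [comp]:
  assumes "computable f" "computable g"
  shows "computable (\<lambda>x. f x + g x)"
proof -
  have "rec_nat a (\<lambda>_. Suc) n = a + n" for a n
    by (induction n) auto
  moreover have "computable (\<lambda>x. rec_nat (f x) (\<lambda>_. Suc) (g x))"
    by (rule computable_rec_nat) (intro assms comp)+
  ultimately show ?thesis
    by simp
qed

lemma computable_mult [comp]:
  assumes "computable f" "computable g"
  shows "computable (\<lambda>x. f x * g x)"
proof -
  have "rec_nat 0 (\<lambda>_ v. v + a) n = a * n" for a n :: nat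
    by (induction n) auto
  moreover have "computable (\<lambda>x. rec_nat 0 (\<lambda>_ v. v + f x) (g x))"
    by (rule computable_rec_nat) (intro assms(2) computable_compose[OF assms(1)] comp)+
  ultimately show ?thesis
    by simp
qed

lemma computable_diff [comp]:
  assumes "computable f" "computable g"
  shows "computable (\<lambda>x. f x - g x)"
proof -
  \<comment> \<open>Predecessor: the recursion discards the accumulated value and returns its
    counter.\<close>
  have "rec_nat 0 (\<lambda>k _. k) n = n - 1" for n :: nat
    by (cases n) auto
  moreover have "computable (\<lambda>x. rec_nat 0 (\<lambda>k _. k) x)"
    by (rule computable_rec_nat) (intro comp)+
  ultimately have pred: "computable (\<lambda>x. x - 1)"
    by simp
  have "rec_nat a (\<lambda>_ v. v - 1) n = a - n" for a n :: nat
    by (induction n) auto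
  moreover have "computable (\<lambda>x. rec_nat (f x) (\<lambda>_ v. v - 1) (g x))"
    by (rule computable_rec_nat) (intro assms computable_compose[OF pred] comp)+
  ultimately show ?thesis
    by simp
qed

lemma computable_if [comp]:
  assumes "decidable P" "computable f" "computable g"
  shows "computable (\<lambda>x. if P x then f x else g x)"
proof -
  \<comment> \<open>A case distinction is a recursion of length 0 or 1.\<close>
  have "computable (\<lambda>x. rec_nat (g x) (\<lambda>_ _. f x) (if P x then 1 else 0))"
    using assms(1) unfolding decidable_def
    by (intro computable_rec_nat assms computable_compose[OF assms(2)] comp)
  moreover have "rec_nat (g x) (\<lambda>_ _. f x) (if P x then 1 else 0) = (if P x then f x else g x)" for x
    by simp
  ultimately show ?thesis
    by simp
qed

lemma decidable_compose: "decidable P \<Longrightarrow> computable f \<Longrightarrow> decidable (\<lambda>x. P (f x))"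
  unfolding decidable_def by (rule computable_compose)

lemma decidable_le [comp]:
  assumes "computable f" "computable g"
  shows "decidable (\<lambda>x. f x \<le> g x)"
proof -
  have "computable (\<lambda>x. 1 - (f x - g x))"
    by (intro assms comp)
  moreover have "1 - (f x - g x) = (if f x \<le> g x then 1 else 0)" for x
    by simp
  ultimately show ?thesis
    by (simp add: decidable_def)
qed

lemma decidable_not [comp]:
  assumes "decidable P"
  shows "decidable (\<lambda>x. \<not> P x)"
proof -
  have "computable (\<lambda>x. if P x then 0 else 1)"
    by (intro assms comp)
  moreover have "(if P x then 0 else 1) = (if \<not> P x then 1 else (0::nat))" for x
    by simp
  ultimately show ?thesis
    by (simp add: decidable_def)
qed

lemma decidable_conj [comp]:
  assumes "decidable P" "decidable Q"
  shows "decidable (\<lambda>x. P x \<and> Q x)"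
proof -
  have "computable (\<lambda>x. if P x then (if Q x then 1 else 0) else 0)"
    by (intro assms comp)
  moreover have "(if P x then (if Q x then 1 else 0) else 0) = (if P x \<and> Q x then 1 else (0::nat))"
    for x
    by simp
  ultimately show ?thesis
    by (simp add: decidable_def)
qed

lemma decidable_disj [comp]:
  "decidable P \<Longrightarrow> decidable Q \<Longrightarrow> decidable (\<lambda>x. P x \<or> Q x)"
  using decidable_not[OF decidable_conj[OF decidable_not decidable_not]] by simp

lemma decidable_imp [comp]:
  "decidable P \<Longrightarrow> decidable Q \<Longrightarrow> decidable (\<lambda>x. P x \<longrightarrow> Q x)"
  unfolding imp_conv_disj by (intro comp)

lemma decidable_less [comp]:
  "computable f \<Longrightarrow> computable g \<Longrightarrow> decidable (\<lambda>x. f x < g x)"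
  unfolding not_le[symmetric] by (intro comp)

lemma decidable_eq [comp]:
  "computable f \<Longrightarrow> computable g \<Longrightarrow> decidable (\<lambda>x. f x = g x)"
  unfolding order_eq_iff by (intro comp)

lemma decidable_all_less [comp]:
  assumes "computable f" "decidable (\<lambda>p. P (dfst p) (dsnd p))"
  shows "decidable (\<lambda>x. \<forall>k<f x. P x k)"
proof -
  have "rec_nat 1 (\<lambda>k v. if P x k then v else 0) n = (if \<forall>k<n. P x k then 1 else (0::nat))" for x n
    by (induction n) (auto simp: less_Suc_eq)
  moreover have "decidable (\<lambda>p. P (dfst p) (dfst (dsnd p)))"
    using decidable_compose[OF assms(2), of "\<lambda>p. prod_encode (dfst p, dfst (dsnd p))"]
    by (simp add: comp)
  then have "computable (\<lambda>x. rec_nat 1 (\<lambda>k v. if P x k then v else 0) (f x))"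
    by (intro computable_rec_nat assms(1) comp)
  ultimately show ?thesis
    by (simp add: decidable_def)
qed

lemma decidable_ex_less [comp]:
  assumes "computable f" "decidable (\<lambda>p. P (dfst p) (dsnd p))"
  shows "decidable (\<lambda>x. \<exists>k<f x. P x k)"
proof -
  have "decidable (\<lambda>x. \<not> (\<forall>k<f x. \<not> P x k))"
    by (intro assms comp)
  then show ?thesis
    by simp
qed

lemma computable_rel_iff:
  "computable_rel r \<longleftrightarrow> decidable (\<lambda>p. (dfst p, dsnd p) \<in> r)"
proof
  assume "computable_rel r"
  then obtain e where "\<And>x y. eval (inv index e) (prod_encode (x, y)) = Some (if (x, y) \<in> r then 1 else 0)"
    unfolding computable_rel_def Phi_def by blast
  then show "decidable (\<lambda>p. (dfst p, dsnd p) \<in> r)"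
    unfolding decidable_def computable_def
    by (intro exI[of _ "inv index e"]) (metis prod.collapse prod_decode_inverse)
next
  assume "decidable (\<lambda>p. (dfst p, dsnd p) \<in> r)"
  then obtain c where "\<And>p. eval c p = Some (if (dfst p, dsnd p) \<in> r then 1 else 0)"
    unfolding decidable_def computable_def by blast
  then show "computable_rel r"
    unfolding computable_rel_def Phi_def
    by (intro exI[of _ "index c"]) (simp add: inv_f_f[OF inj_index])
qed

lemma decidable_mem [comp]:
  assumes "computable_rel r" "computable f" "computable g"
  shows "decidable (\<lambda>x. (f x, g x) \<in> r)"
  using decidable_compose[OF assms(1)[unfolded computable_rel_iff]
      computable_prod_encode[OF assms(2,3)]] by simp

lemma kleene1_index: "kleene1 (index c) x = eval c x"
  by (simp add: kleene1_def Phi_def inv_f_f[OF inj_index])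

section \<open>The recursion theorem\<close>

primrec const_code :: "nat \<Rightarrow> code" where
  "const_code 0 = Zero"
| "const_code (Suc k) = Comp Succ (const_code k)"

text \<open>For \<open>e = index c\<close> this is the index of \<open>c\<close> composed with the
  map taking \<open>x\<close> to the pair of \<open>k\<close> and \<open>x\<close>;
  \<open>code.Pair Left Right\<close> is the identity. Written out as arithmetic, the index is
  computable in \<open>e\<close> and \<open>k\<close>.\<close>

definition smn :: "nat \<Rightarrow> nat \<Rightarrow> nat" where
  "smn e k = 5 + 4 * prod_encode (e,
    4 + 4 * prod_encode (index (const_code k), index (code.Pair Left Right)))"

lemma eval_const_code: "eval (const_code k) x = Some k"
  by (induction k) auto

lemma kleene1_smn: "kleene1 (smn (index c) k) x = eval c (prod_encode (k, x))"
proof -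
  have "smn (index c) k = index (Comp c (code.Pair (const_code k) (code.Pair Left Right)))"
    by (simp add: smn_def)
  then show ?thesis
    by (simp add: kleene1_index eval_const_code del: index.simps)
qed

lemma inj_smn:
  assumes "smn e k = smn e l"
  shows "k = l"
proof -
  have "const_code k = const_code l"
    using assms by (simp add: smn_def inj_eq[OF inj_index] del: index.simps)
  then show ?thesis
    by (metis eval_const_code option.inject)
qed

lemma computable_index_const_code [comp]:
  assumes "computable f"
  shows "computable (\<lambda>x. index (const_code (f x)))"
proof -
  have "index (const_code k) = rec_nat 0 (\<lambda>_ v. 5 + 4 * prod_encode (1, v)) k" for k
    by (induction k) auto
  moreover have "computable (\<lambda>x. rec_nat 0 (\<lambda>_ v. 5 + 4 * prod_encode (1, v)) (f x))"
    by (intro computable_rec_nat assms comp)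
  ultimately show ?thesis
    by simp
qed

text \<open>The program \<open>c\<close> reads its own index from its parameter, so it can output
  the indices of its siblings; feeding it \<open>index c\<close> closes the loop. The tag
  \<open>b\<close> is passed on unchanged, which gives disjoint families of the same shape.\<close>

lemma recursion_theorem_rel:
  assumes R: "decidable (\<lambda>p. R (dfst p) (dsnd p))"
  obtains h where "inj h"
    "\<And>b x y. kleene1 (h (prod_encode (b, x))) y = Some (if R y x then h (prod_encode (b, y)) else 0)"
proof -
  have "decidable (\<lambda>p. R (dsnd p) (dsnd (dsnd (dfst p))))"
    using decidable_compose[OF R, of "\<lambda>p. prod_encode (dsnd p, dsnd (dsnd (dfst p)))"]
    by (simp add: comp)
  then have "computable (\<lambda>p. if R (dsnd p) (dsnd (dsnd (dfst p)))
      then smn (dfst (dfst p)) (prod_encode (dfst (dfst p), prod_encode (dfst (dsnd (dfst p)), dsnd p)))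
      else 0)"
    unfolding smn_def by (intro comp)
  then obtain c where c: "\<And>p. eval c p = Some (if R (dsnd p) (dsnd (dsnd (dfst p)))
      then smn (dfst (dfst p)) (prod_encode (dfst (dfst p), prod_encode (dfst (dsnd (dfst p)), dsnd p)))
      else 0)"
    unfolding computable_def by blast
  show ?thesis
  proof
    show "inj (\<lambda>x. smn (index c) (prod_encode (index c, x)))"
      by (auto intro!: injI dest: inj_smn)
  qed (simp add: kleene1_smn c)
qed

section \<open>The relations sim\<close>

lemma ordinal_zero_succ_limit:
  fixes \<alpha> :: "'b :: infinite ordinal"
  obtains "\<alpha> = ozero" | \<beta> where "\<alpha> = osucc \<beta>" | "is_limit \<alpha>"
  unfolding is_limit_def by blast

lemma less_osucc_iff: "\<alpha> < osucc \<beta> \<longleftrightarrow> \<alpha> \<le> (\<beta> :: 'b :: infinite ordinal)"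
  by (metis le_less_trans less_osucc not_le osucc_le)

text \<open>Each clause of \<open>sim\<close> is preserved by applying both sides to a common
  argument. This is what makes the relations grow at successors.\<close>

lemma sim_App_Elem:
  "sim ap \<alpha> s t \<Longrightarrow> sim ap \<alpha> (App s (Elem x)) (App t (Elem x))"
  for \<alpha> :: "'b :: infinite ordinal"
proof (induction arbitrary: x rule: sim.induct)
  case (sim_zeroI s t)
  then show ?case
    by (intro sim.sim_zeroI) (simp add: kleene_eq_def)
next
  case (sim_succI \<alpha> s t)
  then show ?case
    by (intro sim.sim_succI)
next
  case (sim_limitI \<alpha> \<beta> s t)
  then show ?case
    by (blast intro: sim.sim_limitI)
qed

text \<open>Induction on the larger ordinal. At \<open>osucc \<gamma>\<close> the induction
  hypothesis relates the terms at \<gamma>, and \<open>sim_App_Elem\<close> turns this into the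
  successor clause.\<close>

lemma sim_mono:
  fixes \<alpha> \<beta> :: "'b :: infinite ordinal"
  assumes "sim ap \<alpha> s t" "\<alpha> \<le> \<beta>"
  shows "sim ap \<beta> s t"
  using assms
proof (induction \<beta> arbitrary: s t rule: less_induct)
  case (less \<beta>)
  show ?case
  proof (cases "\<alpha> = \<beta>")
    case False
    then have "\<alpha> < \<beta>"
      using less.prems by simp
    show ?thesis
    proof (cases \<beta> rule: ordinal_zero_succ_limit)
      case 1
      then show ?thesis
        using \<open>\<alpha> < \<beta>\<close> ozero_le leD by blast
    next
      case (2 \<gamma>)
      then show ?thesis
        using less \<open>\<alpha> < \<beta>\<close> by (simp add: sim_osucc less_osucc_iff sim_App_Elem less_osucc)
    next
      case 3
      then show ?thesis
        using less.prems \<open>\<alpha> < \<beta>\<close> by (blast intro: sim_limitI)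
    qed
  qed (use less.prems in simp)
qed

text \<open>The value of an application depends only on the values of its parts. This allows an
  applied program to be replaced by the element that it returns.\<close>

lemma sim_val_cong:
  "sim ap \<alpha> s t \<Longrightarrow> val ap s = val ap s' \<Longrightarrow> val ap t = val ap t' \<Longrightarrow> sim ap \<alpha> s' t'"
  for \<alpha> :: "'b :: infinite ordinal"
proof (induction arbitrary: s' t' rule: sim.induct)
  case (sim_zeroI s t)
  then show ?case
    by (intro sim.sim_zeroI) (simp add: kleene_eq_def)
next
  case (sim_succI \<alpha> s t)
  show ?case
    by (rule sim.sim_succI, rule sim_succI.IH) (simp_all add: sim_succI.prems)
next
  case (sim_limitI \<alpha> \<beta> s t)
  then show ?case
    by (blast intro: sim.sim_limitI)
qed

section \<open>Ordinals represented by well-orders on the natural numbers\<close>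

text \<open>A fixed injection transports well-orders on the naturals into the unrelated infinite
  type \<open>'b\<close>.\<close>

definition nat_emb :: "nat \<Rightarrow> 'b :: infinite" where
  "nat_emb = (SOME f. inj f)"

lemma inj_nat_emb: "inj (nat_emb :: nat \<Rightarrow> 'b :: infinite)"
proof -
  have "\<exists>f :: nat \<Rightarrow> 'b. inj f"
    using arb_countable_map[of "{} :: 'b set"] by auto
  then show ?thesis
    unfolding nat_emb_def by (rule someI_ex)
qed

definition otype :: "nat rel \<Rightarrow> 'b :: infinite ordinal" where
  "otype r = abs_ordinal (dir_image r nat_emb)"

text \<open>For \<open>x\<close> in the field of a well-order this is the ordinal rank of
  \<open>x\<close>.\<close>

definition oseg :: "nat rel \<Rightarrow> nat \<Rightarrow> 'b :: infinite ordinal" where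
  "oseg r x = otype (Restr r (underS r x))"

lemma dir_image_nat_emb:
  assumes "Well_order r"
  shows "r =o (dir_image r (nat_emb :: nat \<Rightarrow> 'b :: infinite))"
  using assms inj_nat_emb by (intro dir_image_ordIso) (auto intro: inj_on_subset)

lemma ordIso_refl_right: "r =o s \<Longrightarrow> s =o s"
  using ordIso_symmetric ordIso_transitive by blast

lemma abs_ordinal_eqI: "r =o s \<Longrightarrow> abs_ordinal r = abs_ordinal s"
  using Quotient3_rel[OF Quotient3_ordinal, of r s] by blast

lemma otype_less_iff:
  assumes "Well_order r" "Well_order s"
  shows "(otype r :: 'b :: infinite ordinal) < otype s \<longleftrightarrow> r <o s"
proof -
  note r = dir_image_nat_emb[OF assms(1), where ?'b = 'b]
    and s = dir_image_nat_emb[OF assms(2), where ?'b = 'b]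
  show ?thesis
    unfolding otype_def
    using less_ordinal.abs_eq[OF ordIso_refl_right[OF r] ordIso_refl_right[OF s]]
    by (meson r s ordIso_symmetric ordIso_ordLess_trans ordLess_ordIso_trans)
qed

lemma computable_ordinal_otype:
  assumes "computable_rel r" "Well_order r"
  shows "computable_ordinal (otype r)"
  unfolding otype_def
  using assms dir_image_nat_emb[OF assms(2)] ordIso_refl_right
  by (subst computable_ordinal.abs_eq) blast+

lemma computable_ordinalE:
  fixes \<alpha> :: "'b :: infinite ordinal"
  assumes "computable_ordinal \<alpha>"
  obtains r where "computable_rel r" "Well_order r" "\<alpha> = otype r"
proof -
  obtain s where s: "s =o s" "\<alpha> = abs_ordinal s"
    by (rule ordinal_cases)
  with assms obtain r where r: "computable_rel r" "r =o s"
    by (auto simp: computable_ordinal.abs_eq)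
  have "Well_order r"
    using r(2) by (simp add: ordIso_def)
  moreover have "abs_ordinal s = (otype r :: 'b ordinal)"
    unfolding otype_def
    by (rule abs_ordinal_eqI[OF ordIso_transitive[OF ordIso_symmetric[OF r(2)]
            dir_image_nat_emb[OF \<open>Well_order r\<close>]]])
  ultimately show ?thesis
    using that r(1) s(2) by blast
qed

lemma oseg_less_otype:
  assumes "Well_order r" "x \<in> Field r"
  shows "oseg r x < otype r"
  unfolding oseg_def otype_less_iff[OF Well_order_Restr[OF assms(1)] assms(1)]
  by (rule underS_Restr_ordLess) (use assms in auto)

lemma oseg_cases:
  fixes \<beta> :: "'b :: infinite ordinal"
  assumes "Well_order r" "\<beta> < otype r"
  obtains x where "x \<in> Field r" "\<beta> = oseg r x"
proof -
  obtain s where s: "s =o s" "\<beta> = abs_ordinal s"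
    by (rule ordinal_cases)
  note r = dir_image_nat_emb[OF assms(1), where ?'b = 'b]
  have "Well_order s"
    using s(1) by (simp add: ordIso_def)
  have "s <o dir_image r (nat_emb :: nat \<Rightarrow> 'b)"
    using assms(2) less_ordinal.abs_eq[OF s(1) ordIso_refl_right[OF r]]
    unfolding otype_def s(2) by blast
  then have "s <o r"
    by (rule ordLess_ordIso_trans[OF _ ordIso_symmetric[OF r]])
  then obtain x where x: "x \<in> Field r" "s =o Restr r (underS r x)"
    unfolding ordLess_iff_ordIso_Restr[OF assms(1) \<open>Well_order s\<close>] ..
  have "\<beta> = oseg r x"
    unfolding oseg_def otype_def s(2)
    by (rule abs_ordinal_eqI[OF ordIso_transitive[OF x(2)
            dir_image_nat_emb[OF Well_order_Restr[OF assms(1)]]]])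
  then show ?thesis
    using that x(1) by blast
qed

text \<open>Apply \<open>oseg_less_otype\<close> inside the restriction of \<open>r\<close> to the
  predecessors of \<open>x\<close>, where \<open>y\<close> has the same predecessors as in
  \<open>r\<close>.\<close>

lemma oseg_less:
  assumes "Well_order r" "(y, x) \<in> r" "y \<noteq> x"
  shows "oseg r y < oseg r x"
proof -
  interpret w: wo_rel r
    using assms(1) by (simp add: wo_rel_def)
  have sub: "underS r y \<subseteq> underS r x"
    using w.TRANS w.ANTISYM underS_incr assms by metis
  have y: "y \<in> underS r x"
    using assms by (simp add: underS_def)
  have F: "Field (Restr r (underS r x)) = underS r x"
    using Refl_Field_Restr2[OF w.REFL Order_Relation.underS_Field] .
  have "underS (Restr r (underS r x)) y = underS r y"
    using sub y by (auto simp: underS_def)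
  then have "Restr r (underS r y) = Restr (Restr r (underS r x)) (underS (Restr r (underS r x)) y)"
    using sub by auto
  then have eq: "oseg r y = oseg (Restr r (underS r x)) y"
    unfolding oseg_def by simp
  have "oseg (Restr r (underS r x)) y < otype (Restr r (underS r x))"
    by (rule oseg_less_otype[OF Well_order_Restr[OF assms(1)]]) (simp only: F y)
  then show ?thesis
    unfolding eq[symmetric] oseg_def[of r x] .
qed

lemma oseg_less_iff:
  assumes "Well_order r" "x \<in> Field r" "y \<in> Field r"
  shows "(oseg r y :: 'b :: infinite ordinal) < oseg r x \<longleftrightarrow> (y, x) \<in> r \<and> y \<noteq> x"
proof -
  interpret w: wo_rel r
    using assms(1) by (simp add: wo_rel_def)
  show ?thesis
    using oseg_less[OF assms(1)] w.TOTALS assms(2,3) by (metis less_asym)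
qed

text \<open>This makes the computable ordinals closed downwards: a segment is decided by
  \<open>r\<close> with its end \<open>x\<close> as a fixed parameter.\<close>

lemma computable_oseg:
  assumes "computable_rel r" "Well_order r"
  shows "computable_ordinal (oseg r x)"
proof -
  have "Restr r (underS r x) =
      {(a, b). (a, b) \<in> r \<and> (a \<noteq> x \<and> (a, x) \<in> r) \<and> b \<noteq> x \<and> (b, x) \<in> r}"
    by (auto simp: underS_def)
  moreover have "computable_rel \<dots>"
    unfolding computable_rel_iff mem_Collect_eq case_prod_conv by (intro assms(1) comp)
  ultimately show ?thesis
    unfolding oseg_def by (intro computable_ordinal_otype Well_order_Restr assms(2)) simp
qed

text \<open>A Burali-Forti argument. If all ordinals were computable, choosing an index for each
  would inject them into the naturals, and the image of their order would be a well-order too long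
  for its own order type.\<close>

lemma ex_noncomputable: "\<exists>\<alpha> :: 'b :: infinite ordinal. \<not> computable_ordinal \<alpha>"
proof (rule ccontr)
  assume computable: "\<not> ?thesis"
  have "\<forall>\<alpha> :: 'b ordinal. \<exists>e r. otype r = \<alpha> \<and>
      (\<forall>x y. Phi e (prod_encode (x, y)) = Some (if (x, y) \<in> r then 1 else 0))"
  proof
    fix \<alpha> :: "'b ordinal"
    obtain r where "computable_rel r" "\<alpha> = otype r"
      using computable computable_ordinalE[of \<alpha>] by blast
    then show "\<exists>e r. otype r = \<alpha> \<and>
        (\<forall>x y. Phi e (prod_encode (x, y)) = Some (if (x, y) \<in> r then 1 else 0))"
      unfolding computable_rel_def by blast
  qed
  from choice[OF this] obtain e where "\<forall>\<alpha> :: 'b ordinal. \<exists>r. otype r = \<alpha> \<and>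
      (\<forall>x y. Phi (e \<alpha>) (prod_encode (x, y)) = Some (if (x, y) \<in> r then 1 else 0))" ..
  from choice[OF this] obtain r where "\<forall>\<alpha> :: 'b ordinal. otype (r \<alpha>) = \<alpha> \<and>
      (\<forall>x y. Phi (e \<alpha>) (prod_encode (x, y)) = Some (if (x, y) \<in> r \<alpha> then 1 else 0))" ..
  then have r: "\<And>\<alpha>. otype (r \<alpha>) = (\<alpha> :: 'b ordinal)"
    "\<And>\<alpha> x y. Phi (e \<alpha>) (prod_encode (x, y)) = Some (if (x, y) \<in> r \<alpha> then 1 else 0)"
    by simp_all
  have "inj e"
  proof (rule injI)
    fix \<alpha> \<beta> assume "e \<alpha> = e \<beta>"
    then have eq: "Some (if (x, y) \<in> r \<alpha> then 1 else 0 :: nat) = Some (if (x, y) \<in> r \<beta> then 1 else 0)"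
      for x y
      unfolding r(2)[symmetric] by simp
    have "(x, y) \<in> r \<alpha> \<longleftrightarrow> (x, y) \<in> r \<beta>" for x y
      using eq[of x y] by (simp split: if_splits)
    then have "r \<alpha> = r \<beta>"
      by auto
    then have "otype (r \<alpha>) = (otype (r \<beta>) :: 'b ordinal)"
      by simp
    then show "\<alpha> = \<beta>"
      unfolding r(1) .
  qed
  define q where "q = {(\<alpha>, \<beta>). \<alpha> \<le> (\<beta> :: 'b ordinal)}"
  have Fq: "Field q = UNIV"
    by (auto simp: q_def Field_def)
  have "q - Id = {(\<alpha>, \<beta>). \<alpha> < \<beta>}"
    by (auto simp: q_def)
  then have "wf (q - Id)"
    by (simp add: wf)
  moreover have "refl q" "trans q" "antisym q" "total q"
    by (auto simp: q_def refl_on_def trans_def antisym_def total_on_def)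
  ultimately have q: "Well_order q"
    unfolding order_on_defs Fq by simp
  define w where "w = dir_image q e"
  have w: "Well_order w"
    unfolding w_def by (rule Well_order_dir_image[OF q]) (use \<open>inj e\<close> in \<open>auto intro: inj_on_subset\<close>)
  have mono: "oseg w (e \<alpha>) < (oseg w (e \<beta>) :: 'b ordinal)" if "\<alpha> < \<beta>" for \<alpha> \<beta>
    using that \<open>inj e\<close> by (intro oseg_less[OF w]) (auto simp: w_def dir_image_def q_def inj_eq)
  \<comment> \<open>A strictly increasing map of the ordinals lies above the identity; at
    \<open>otype w\<close> this contradicts that segments of \<open>w\<close> are shorter than
    \<open>w\<close>.\<close>
  have "\<alpha> \<le> (oseg w (e \<alpha>) :: 'b ordinal)" for \<alpha>
  proof (induction \<alpha> rule: less_induct)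
    case (less \<alpha>)
    show ?case
    proof (rule leI notI)+
      assume lt: "oseg w (e \<alpha>) < \<alpha>"
      from less.IH[OF lt] mono[OF lt] show False
        by (rule leD[THEN notE])
    qed
  qed
  from this[of "otype w"] have "\<not> oseg w (e (otype w)) < (otype w :: 'b ordinal)"
    by simp
  moreover have "oseg w (e (otype w)) < (otype w :: 'b ordinal)"
    by (rule oseg_less_otype[OF w]) (simp add: w_def dir_image_Field Fq)
  ultimately show False
    by (rule notE)
qed

text \<open>Below the least non-computable ordinal, minimality applies. A computable ordinal above
  it would have it as the type of an initial segment, hence as a computable ordinal.\<close>

lemma computable_iff_less_omega1_CK:
  fixes \<alpha> :: "'b :: infinite ordinal"
  shows "computable_ordinal \<alpha> \<longleftrightarrow> \<alpha> < omega1_CK"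
proof
  have nc: "\<not> computable_ordinal (omega1_CK :: 'b ordinal)"
    unfolding omega1_CK_def using ex_noncomputable by (rule LeastI_ex)
  assume "computable_ordinal \<alpha>"
  then obtain r where r: "computable_rel r" "Well_order r" "\<alpha> = otype r"
    by (rule computable_ordinalE)
  show "\<alpha> < omega1_CK"
  proof (rule ccontr)
    assume "\<not> \<alpha> < omega1_CK"
    then have "omega1_CK = \<alpha> \<or> omega1_CK < \<alpha>"
      by auto
    then show False
      using nc \<open>computable_ordinal \<alpha>\<close> oseg_cases[OF r(2)] computable_oseg[OF r(1,2)] r(3) by metis
  qed
next
  show "\<alpha> < omega1_CK \<Longrightarrow> computable_ordinal \<alpha>"
    unfolding omega1_CK_def using not_less_Least by blast
qed

section \<open>Lists coded by natural numbers\<close>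

text \<open>The code of a nonempty list is the successor of a pair of head and coded tail, so the
  head is read off after subtracting 1. Dropping is an iterated tail on codes.\<close>

definition nth_code :: "nat \<Rightarrow> nat \<Rightarrow> nat" where
  "nth_code w i = dfst (list_encode (drop i (list_decode w)) - 1)"

lemma list_encode_eq_0_iff: "list_encode xs = 0 \<longleftrightarrow> xs = []"
  by (cases xs) auto

lemma prod_decode_0: "prod_decode 0 = (0, 0)"
  by (simp add: prod_decode_def prod_decode_aux.simps)

lemma list_encode_tl: "list_encode (tl xs) = dsnd (list_encode xs - 1)"
  by (cases xs) (simp_all add: prod_decode_0)

lemma nth_code_eq: "i < length (list_decode w) \<Longrightarrow> nth_code w i = list_decode w ! i"
  by (simp add: nth_code_def Cons_nth_drop_Suc[symmetric])

text \<open>Entries, like lengths in \<open>length_le_list_encode\<close>, are bounded by the code,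
  so quantifiers over them can be bounded.\<close>

lemma mem_list_less_list_encode: "x \<in> set xs \<Longrightarrow> x < list_encode xs"
proof (induction xs)
  case (Cons y xs)
  then show ?case
    using le_prod_encode_1[of y "list_encode xs"] le_prod_encode_2[of "list_encode xs" y] by auto
qed simp

lemma length_le_list_encode: "length xs \<le> list_encode xs"
proof (induction xs)
  case (Cons y xs)
  then show ?case
    using le_prod_encode_2[of "list_encode xs" y] by auto
qed simp

lemma mem_list_decode_less: "x \<in> set (list_decode w) \<Longrightarrow> x < w"
  using mem_list_less_list_encode[of x "list_decode w"] by simp

lemma length_list_decode_le: "length (list_decode w) \<le> w"
  using length_le_list_encode[of "list_decode w"] by simp

lemma computable_drop [comp]:
  assumes "computable f" "computable g"
  shows "computable (\<lambda>x. list_encode (drop (f x) (list_decode (g x))))"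
proof -
  have "rec_nat w (\<lambda>_ v. dsnd (v - 1)) i = list_encode (drop i (list_decode w))" for w i
    by (induction i) (simp_all add: drop_Suc tl_drop[symmetric] flip: list_encode_tl One_nat_def)
  moreover have "computable (\<lambda>x. rec_nat (g x) (\<lambda>_ v. dsnd (v - 1)) (f x))"
    by (intro computable_rec_nat assms comp)
  ultimately show ?thesis
    by simp
qed

lemma computable_nth_code [comp]:
  assumes "computable f" "computable g"
  shows "computable (\<lambda>x. nth_code (g x) (f x))"
  unfolding nth_code_def by (intro assms comp)

lemma computable_length [comp]:
  assumes "computable f"
  shows "computable (\<lambda>x. length (list_decode (f x)))"
proof -
  let ?g = "\<lambda>w i v. if list_encode (drop i (list_decode w)) = 0 then v else Suc v"
  have "rec_nat 0 (?g w) n = min n (length (list_decode w))" for w n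
    by (induction n) (auto simp: list_encode_eq_0_iff)
  then have "rec_nat 0 (?g w) w = length (list_decode w)" for w
    using length_list_decode_le[of w] by simp
  moreover have "computable (\<lambda>x. rec_nat 0 (?g (f x)) (f x))"
    by (intro computable_rec_nat computable_compose[OF assms] assms comp)
  ultimately show ?thesis
    by simp
qed

lemma decidable_mem_list_decode [comp]:
  assumes "computable f" "computable g"
  shows "decidable (\<lambda>x. f x \<in> set (list_decode (g x)))"
proof -
  have "decidable (\<lambda>x. \<exists>i<g x. i < length (list_decode (g x)) \<and> nth_code (g x) i = f x)"
    by (intro computable_compose[OF assms(1)] computable_compose[OF assms(2)] assms comp)
  moreover have "(\<exists>i<w. i < length (list_decode w) \<and> nth_code w i = y) \<longleftrightarrow> y \<in> set (list_decode w)"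
    for w y
    using length_list_decode_le[of w] by (auto simp: in_set_conv_nth nth_code_eq)
      (metis less_le_trans nth_code_eq)
  ultimately show ?thesis
    by simp
qed

section \<open>The Kleene-Brouwer order\<close>

text \<open>Extensions precede their prefixes, so that going down a tree is descending in the
  order.\<close>

fun kb :: "nat list \<Rightarrow> nat list \<Rightarrow> bool" where
  "kb [] ys \<longleftrightarrow> False"
| "kb (x # xs) [] \<longleftrightarrow> True"
| "kb (x # xs) (y # ys) \<longleftrightarrow> x < y \<or> x = y \<and> kb xs ys"

lemma kb_irrefl: "\<not> kb xs xs"
  by (induction xs) auto

lemma kb_trans: "kb xs ys \<Longrightarrow> kb ys zs \<Longrightarrow> kb xs zs"
proof (induction xs ys arbitrary: zs rule: kb.induct)
  case (2 x xs)
  then show ?case by simp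
next
  case (3 x xs y ys)
  then show ?case by (cases zs) auto
qed simp

lemma kb_total: "xs \<noteq> ys \<Longrightarrow> kb xs ys \<or> kb ys xs"
proof (induction xs ys rule: kb.induct)
  case (1 ys)
  then show ?case by (cases ys) auto
qed auto

lemma kb_append: "kb (xs @ us) (xs @ vs) \<longleftrightarrow> kb us vs"
  by (induction xs) auto

text \<open>The index \<open>i\<close> is the first place where the lists differ or
  \<open>ys\<close> has ended. This form has bounded quantifiers only, as decidability
  requires.\<close>

lemma kb_iff:
  "kb xs ys \<longleftrightarrow> (\<exists>i<length xs. (\<forall>j<i. j < length ys \<and> xs ! j = ys ! j) \<and>
    (i < length ys \<longrightarrow> xs ! i < ys ! i))"
  by (induction xs ys rule: kb.induct) (auto simp: Ex_less_Suc2 All_less_Suc2)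

lemma decidable_kb [comp]:
  assumes "computable f" "computable g"
  shows "decidable (\<lambda>x. kb (list_decode (f x)) (list_decode (g x)))"
proof -
  have "kb (list_decode s) (list_decode t) \<longleftrightarrow> (\<exists>i<s. i < length (list_decode s) \<and>
      (\<forall>j<i. j < length (list_decode t) \<and> nth_code s j = nth_code t j) \<and>
      (i < length (list_decode t) \<longrightarrow> nth_code s i < nth_code t i))" for s t
    unfolding kb_iff using length_list_decode_le[of s]
    by (intro ex_cong1) (auto simp: nth_code_eq)
  moreover have "decidable (\<lambda>x. \<exists>i<f x. i < length (list_decode (f x)) \<and>
      (\<forall>j<i. j < length (list_decode (g x)) \<and> nth_code (f x) j = nth_code (g x) j) \<and>
      (i < length (list_decode (g x)) \<longrightarrow> nth_code (f x) i < nth_code (g x) i))"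
    by (intro computable_compose[OF assms(1)] computable_compose[OF assms(2)] assms comp)
  ultimately show ?thesis
    by simp
qed

lemma acc_no_infinite_chain:
  assumes "a \<in> Wellfounded.acc r" "c 0 = a"
  shows "\<not> (\<forall>i. (c (Suc i), c i) \<in> r)"
  using assms
proof (induction a arbitrary: c rule: acc.induct)
  case (accI a)
  show ?case
  proof
    assume chain: "\<forall>i. (c (Suc i), c i) \<in> r"
    then have "(c (Suc 0), a) \<in> r"
      using accI.prems by blast
    from accI.IH[OF this, of "\<lambda>i. c (Suc i)"] chain show False
      by blast
  qed
qed

section \<open>The tree of finitely tested descending sequences\<close>

locale Pi1_relation =
  fixes D :: "nat \<Rightarrow> nat \<Rightarrow> nat \<Rightarrow> bool" and a0 :: nat
  assumes decidable_D: "decidable (\<lambda>p. D (dfst p) (dfst (dsnd p)) (dsnd (dsnd p)))"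
    and acc: "a0 \<in> Wellfounded.acc {(b, a). \<forall>k. D a b k}"
begin

definition path :: "nat list \<Rightarrow> bool" where
  "path xs \<longleftrightarrow> 0 < length xs \<and> xs ! 0 = a0 \<and>
    (\<forall>i. Suc i < length xs \<longrightarrow> (\<forall>k. D (xs ! i) (xs ! Suc i) k))"

definition node :: "nat list \<Rightarrow> bool" where
  "node xs \<longleftrightarrow> 0 < length xs \<and> xs ! 0 = a0 \<and>
    (\<forall>i. Suc i < length xs \<longrightarrow> (\<forall>k<length xs. D (xs ! i) (xs ! Suc i) k))"

definition child :: "(nat list \<times> nat list) set" where
  "child = {(ys, xs). node xs \<and> node ys \<and> (\<exists>b. ys = xs @ [b])}"

lemma path_imp_node: "path xs \<Longrightarrow> node xs"
  by (simp add: path_def node_def)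

lemma node_prefix: "node (xs @ ys) \<Longrightarrow> xs \<noteq> [] \<Longrightarrow> node xs"
  unfolding node_def by (auto simp: nth_append split: if_splits)

text \<open>Along an infinite branch the lengths are unbounded, so every instance of every step is
  eventually tested. The branch is then a genuine descending sequence from \<open>a0\<close>,
  against \<open>acc\<close>.\<close>

lemma wf_child: "wf child"
  unfolding wf_iff_no_infinite_down_chain
proof
  assume "\<exists>f. \<forall>i. (f (Suc i), f i) \<in> child"
  then obtain f where f: "\<And>i. (f (Suc i), f i) \<in> child"
    by blast
  have node: "node (f i)" for i
    using f[of i] by (simp add: child_def)
  have ext: "\<exists>b. f (Suc i) = f i @ [b]" for i
    using f[of i] by (auto simp: child_def)
  have len: "i < length (f i)" for i
  proof (induction i)
    case 0
    then show ?case
      using node[of 0] by (simp add: node_def)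
  next
    case (Suc i)
    then show ?case
      using ext[of i] by auto
  qed
  have nth: "f (j + d) ! i = f j ! i" if "i < length (f j)" for i j d
  proof -
    have "\<exists>zs. f (j + d) = f j @ zs"
    proof (induction d)
      case (Suc d)
      then show ?case
        using ext[of "j + d"] by auto
    qed simp
    then show ?thesis
      using that by (auto simp: nth_append)
  qed
  define c where "c i = f i ! i" for i
  have "c 0 = a0"
    using node[of 0] by (simp add: c_def node_def)
  moreover have "D (c i) (c (Suc i)) k" for i k
  proof -
    have n: "Suc i + k < length (f (Suc i + k))"
      by (rule len)
    \<comment> \<open>The node at position \<open>Suc i + k\<close> is longer than both
      \<open>Suc i\<close> and \<open>k\<close>, so it tests instance \<open>k\<close> of this
      step.\<close>
    have "D (f (Suc i + k) ! i) (f (Suc i + k) ! Suc i) k"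
      using node[of "Suc i + k"] n unfolding node_def by auto
    moreover have "f (Suc i + k) ! Suc i = c (Suc i)"
      unfolding c_def by (rule nth[OF len])
    moreover have "f (Suc i + k) ! i = c i"
      unfolding c_def using nth[OF len, of i "Suc k"] by simp
    ultimately show ?thesis
      by simp
  qed
  ultimately show False
    using acc_no_infinite_chain[OF acc] by blast
qed

text \<open>Induction down the tree, with \<open>Q\<close> a set of continuations of
  \<open>xs\<close>. If a nonempty one is available, a minimal one starts with the least possible
  next entry \<open>b\<close>, and its rest comes from the hypothesis at \<open>xs @ [b]\<close>;
  otherwise the empty one is minimal.\<close>

lemma kb_minimal:
  assumes "node xs" "u \<in> Q" "node (xs @ u)"
  shows "\<exists>z\<in>Q. node (xs @ z) \<and> (\<forall>y\<in>Q. node (xs @ y) \<longrightarrow> \<not> kb y z)"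
  using wf_child assms
proof (induction xs arbitrary: u Q rule: wf_induct_rule)
  case (less xs)
  show ?case
  proof (cases "\<exists>b v. b # v \<in> Q \<and> node (xs @ b # v)")
    case False
    then have "u = []"
      using less.prems by (cases u) auto
    moreover have "\<not> kb y []" if "y \<in> Q" "node (xs @ y)" for y
      using False that by (cases y) auto
    ultimately show ?thesis
      using less.prems by blast
  next
    case True
    define b where "b = (LEAST b. \<exists>v. b # v \<in> Q \<and> node (xs @ b # v))"
    have least: "b \<le> c" if "c # v \<in> Q" "node (xs @ c # v)" for c v
      unfolding b_def using that by (intro Least_le) blast
    obtain v where v: "b # v \<in> Q" "node (xs @ b # v)"
      using LeastI_ex[OF True] unfolding b_def by blast
    then have "node (xs @ [b])"
      using node_prefix[of "xs @ [b]" v] by simp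
    moreover from this have "(xs @ [b], xs) \<in> child"
      using less.prems by (simp add: child_def)
    ultimately obtain z where z: "b # z \<in> Q" "node (xs @ b # z)"
      "\<And>y. b # y \<in> Q \<Longrightarrow> node (xs @ b # y) \<Longrightarrow> \<not> kb y z"
      using less.IH[of "xs @ [b]" v "{u. b # u \<in> Q}"] v by auto
    have "\<not> kb y (b # z)" if "y \<in> Q" "node (xs @ y)" for y
      using that least z(3) by (cases y) (auto simp: not_less[symmetric])
    then show ?thesis
      using z by blast
  qed
qed

definition kb_order :: "nat rel" where
  "kb_order = {(s, t). node (list_decode s) \<and> node (list_decode t) \<and>
    (s = t \<or> kb (list_decode s) (list_decode t))}"

lemma Field_kb_order: "Field kb_order = {s. node (list_decode s)}"
  by (auto simp: kb_order_def Field_def)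

lemma list_decode_eq_iff: "list_decode s = list_decode t \<longleftrightarrow> s = t"
  by (metis list_decode_inverse)

lemma Well_order_kb_order: "Well_order kb_order"
proof -
  have "wf (kb_order - Id)"
    unfolding wf_eq_minimal
  proof (intro allI impI)
    fix Q :: "nat set" and s assume s: "s \<in> Q"
    show "\<exists>z\<in>Q. \<forall>y. (y, z) \<in> kb_order - Id \<longrightarrow> y \<notin> Q"
    proof (cases "\<exists>t\<in>Q. node (list_decode t)")
      case False
      then show ?thesis
        using s by (auto simp: kb_order_def)
    next
      case True
      then obtain t where t: "t \<in> Q" "node (list_decode t)"
        by blast
      \<comment> \<open>All nodes start with \<open>a0\<close>, so minimality below the root is
        minimality overall.\<close>
      have root: "\<exists>u. xs = [a0] @ u" if "node xs" for xs
        using that by (cases xs) (auto simp: node_def)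
      obtain u where u: "list_decode t = [a0] @ u"
        using root[OF t(2)] by blast
      obtain z where z: "[a0] @ z \<in> list_decode ` Q"
        "\<And>y. [a0] @ y \<in> list_decode ` Q \<Longrightarrow> node ([a0] @ y) \<Longrightarrow> \<not> kb y z"
        using kb_minimal[of "[a0]" u "{u. [a0] @ u \<in> list_decode ` Q}"] t u
          node_prefix[of "[a0]" u] by (metis (mono_tags, lifting) image_eqI mem_Collect_eq not_Cons_self2)
      then obtain q where q: "q \<in> Q" "list_decode q = [a0] @ z"
        by auto
      show ?thesis
      proof (intro bexI[of _ q] allI impI notI)
        fix y assume y: "(y, q) \<in> kb_order - Id" "y \<in> Q"
        then have "node (list_decode y)" "kb (list_decode y) (list_decode q)"
          by (auto simp: kb_order_def)
        moreover from root[OF this(1)] obtain u where "list_decode y = [a0] @ u" ..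
        ultimately show False
          using z(2)[of u] y(2) q(2) kb_append[of "[a0]"] by (metis image_eqI)
      qed (rule q(1))
    qed
  qed
  moreover have "antisym kb_order" "trans kb_order"
    using kb_trans kb_irrefl by (auto simp: kb_order_def antisym_def trans_def)
  moreover have "Refl kb_order" "Total kb_order"
    unfolding refl_on_def total_on_def Field_kb_order
    using kb_total list_decode_eq_iff by (auto simp: kb_order_def)
  ultimately show ?thesis
    unfolding order_on_defs by (auto intro: FieldI1 FieldI2)
qed

lemma computable_kb_order: "computable_rel kb_order"
proof -
  have "node (list_decode s) \<longleftrightarrow> 0 < length (list_decode s) \<and> nth_code s 0 = a0 \<and>
      (\<forall>i<s. Suc i < length (list_decode s) \<longrightarrow>
        (\<forall>k<s. k < length (list_decode s) \<longrightarrow> D (nth_code s i) (nth_code s (Suc i)) k))" for s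
    unfolding node_def using length_list_decode_le[of s]
    by (auto simp: nth_code_eq simp flip: length_greater_0_conv)
  moreover have D: "decidable (\<lambda>p. D (f p) (g p) (h p))"
    if "computable f" "computable g" "computable h" for f g h
    using decidable_compose[OF decidable_D, of "\<lambda>p. prod_encode (f p, prod_encode (g p, h p))"] that
    by (simp add: comp)
  have "decidable (\<lambda>s. 0 < length (list_decode s) \<and> nth_code s 0 = a0 \<and>
      (\<forall>i<s. Suc i < length (list_decode s) \<longrightarrow>
        (\<forall>k<s. k < length (list_decode s) \<longrightarrow> D (nth_code s i) (nth_code s (Suc i)) k)))"
    by (intro D comp)
  ultimately have node: "decidable (\<lambda>s. node (list_decode s))"
    by simp
  show ?thesis
    unfolding computable_rel_iff kb_order_def mem_Collect_eq case_prod_conv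
    by (intro decidable_compose[OF node] comp)
qed

lemma path_extend:
  assumes "path xs" "\<And>k. D (last xs) b k"
  shows "path (xs @ [b])"
  unfolding path_def
proof (intro conjI allI impI)
  show "0 < length (xs @ [b])" "(xs @ [b]) ! 0 = a0"
    using assms(1) by (simp_all add: path_def nth_append)
  fix i k assume "Suc i < length (xs @ [b])"
  then consider "Suc i < length xs" | "Suc i = length xs"
    by fastforce
  then show "D ((xs @ [b]) ! i) ((xs @ [b]) ! Suc i) k"
  proof cases
    case 1
    then show ?thesis
      using assms(1) by (simp add: path_def nth_append)
  next
    case 2
    moreover from this have "last xs = xs ! i"
      by (metis diff_Suc_1 last_conv_nth list.size(3) nat.distinct(1))
    ultimately show ?thesis
      using assms(2) by (simp add: nth_append)
  qed
qed

lemma kb_order_path_extend: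
  assumes "path (list_decode s)" "\<And>k. D (last (list_decode s)) b k"
  shows "(list_encode (list_decode s @ [b]), s) \<in> kb_order - Id"
  using path_imp_node[OF path_extend[OF assms]] path_imp_node[OF assms(1)]
    kb_append[of "list_decode s" "[b]" "[]"] kb_irrefl[of "list_decode s"]
  by (auto simp: kb_order_def) (metis list_encode_inverse)

end

text \<open>
  Requiring the \<open>k\<close>-th instance of a \<open>\<Pi>\<^sub>1\<close> condition only on nodes longer than
  \<open>k\<close> makes the tree of descending sequences decidable without adding infinite paths.
\<close>

lemma computable_well_order_above_Pi1_relation:
  assumes "decidable (\<lambda>p. D (dfst p) (dfst (dsnd p)) (dsnd (dsnd p)))"
    and "a0 \<in> Wellfounded.acc {(b, a). \<forall>k. D a b k}"
  obtains r rep x0 where "computable_rel r" "Well_order r" "rep x0 a0"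
    "\<And>x a. rep x a \<Longrightarrow> x \<in> Field r"
    "\<And>x a b. rep x a \<Longrightarrow> (\<And>k. D a b k) \<Longrightarrow> \<exists>y. (y, x) \<in> r - Id \<and> rep y b"
proof -
  interpret Pi1_relation D a0
    using assms by unfold_locales
  \<comment> \<open>One \<open>a\<close> may be represented by several \<open>x\<close>, since the
    tree unravels the relation.\<close>
  define rep where "rep x a \<longleftrightarrow> path (list_decode x) \<and> last (list_decode x) = a" for x a
  show thesis
  proof
    show "computable_rel kb_order" "Well_order kb_order"
      by (rule computable_kb_order Well_order_kb_order)+
    show "rep (list_encode [a0]) a0"
      unfolding rep_def list_encode_inverse by (simp add: path_def)
    show "x \<in> Field kb_order" if "rep x a" for x a
      using that path_imp_node by (simp add: rep_def Field_kb_order)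
    show "\<exists>y. (y, x) \<in> kb_order - Id \<and> rep y b" if "rep x a" "\<And>k. D a b k" for x a b
    proof (intro exI conjI)
      show "(list_encode (list_decode x @ [b]), x) \<in> kb_order - Id"
        using that unfolding rep_def by (intro kb_order_path_extend) auto
      show "rep (list_encode (list_decode x @ [b])) b"
        using that path_extend unfolding rep_def list_encode_inverse by auto
    qed
  qed
qed

section \<open>Kleene's computation predicate\<close>

text \<open>
  \<open>step T c x y\<close>: one rule of evaluation yields \<open>y\<close> as value of \<open>c\<close> at \<open>x\<close> from the triples in \<open>T\<close>.
  A set of triples closed under such justifications is sound without any ordering of its
  entries, because each rule descends in the code or in the recursion argument.
\<close>

primrec step :: "(nat \<Rightarrow> nat \<Rightarrow> nat \<Rightarrow> bool) \<Rightarrow> code \<Rightarrow> nat \<Rightarrow> nat \<Rightarrow> bool" where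
  "step T Zero x y \<longleftrightarrow> y = 0"
| "step T Succ x y \<longleftrightarrow> y = Suc x"
| "step T Left x y \<longleftrightarrow> y = dfst x"
| "step T Right x y \<longleftrightarrow> y = dsnd x"
| "step T (Pair f g) x y \<longleftrightarrow>
    (\<exists>p q. T (index f) x p \<and> T (index g) x q \<and> y = prod_encode (p, q))"
| "step T (Comp f g) x y \<longleftrightarrow> (\<exists>q. T (index g) x q \<and> T (index f) q y)"
| "step T (Prec f g) x y \<longleftrightarrow>
    dsnd x = 0 \<and> T (index f) (dfst x) y \<or>
    0 < dsnd x \<and> (\<exists>v. T (index (Prec f g)) (prod_encode (dfst x, dsnd x - 1)) v \<and>
      T (index g) (prod_encode (dfst x, prod_encode (dsnd x - 1, v))) y)"
| "step T (Mu f) x y \<longleftrightarrow> T (index f) (prod_encode (x, y)) 0 \<and>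
    (\<forall>m<y. \<exists>v. T (index f) (prod_encode (x, m)) (Suc v))"

lemma step_mono: "step T c x y \<Longrightarrow> (\<And>n x y. T n x y \<Longrightarrow> T' n x y) \<Longrightarrow> step T' c x y"
  by (cases c) (simp_all del: index.simps, (blast | metis)+)

lemma eval_Prec_0: "dsnd x = 0 \<Longrightarrow> eval (Prec f g) x = eval f (dfst x)"
  by (simp add: case_prod_unfold)

lemma eval_Prec_Suc: "0 < dsnd x \<Longrightarrow> eval (Prec f g) x =
    Option.bind (eval (Prec f g) (prod_encode (dfst x, dsnd x - 1)))
      (\<lambda>v. eval g (prod_encode (dfst x, prod_encode (dsnd x - 1, v))))"
  by (cases "dsnd x") (simp_all add: case_prod_unfold)

lemma step_sound:
  assumes T: "\<And>c x y. T (index c) x y \<Longrightarrow> step T c x y"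
  shows "T (index c) x y \<Longrightarrow> eval c x = Some y"
proof (induction c arbitrary: x y)
  case (Pair f g)
  then show ?case
    using T[OF Pair.prems] by (auto simp del: index.simps)
next
  case (Comp f g)
  then show ?case
    using T[OF Comp.prems] by (auto simp del: index.simps)
next
  case (Prec f g)
  show ?case
    using Prec.prems
  \<comment> \<open>The rule for \<open>Prec\<close> has a premise with the same code, in which only
    the recursion counter descends.\<close>
  proof (induction "dsnd x" arbitrary: x y)
    case 0
    then show ?case
      using T[OF "0.prems"] Prec.IH by (simp add: eval_Prec_0 del: index.simps eval.simps)
  next
    case (Suc k)
    then obtain v where
      "T (index (Prec f g)) (prod_encode (dfst x, dsnd x - 1)) v"
      "T (index g) (prod_encode (dfst x, prod_encode (dsnd x - 1, v))) y"
      using T[OF Suc.prems] by (auto simp del: index.simps)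
    then show ?case
      using Suc.hyps Prec.IH(2) by (simp add: eval_Prec_Suc del: index.simps eval.simps)
  qed
next
  case (Mu f)
  then have y: "eval f (prod_encode (x, y)) = Some 0"
    "\<And>m. m < y \<Longrightarrow> \<exists>v. eval f (prod_encode (x, m)) = Some (Suc v)"
    using T[OF Mu.prems] by (auto simp del: index.simps)
  then have "(LEAST n. eval f (prod_encode (x, n)) = Some 0) = y"
    by (intro Least_equality) (auto simp: not_less[symmetric] dest: y(2))
  then show ?case
    using y by auto
qed (use T in \<open>fastforce simp del: index.simps\<close>)+

section \<open>Finite coherent sets of triples\<close>

definition coherent :: "(nat \<times> nat \<times> nat) set \<Rightarrow> bool" where
  "coherent S \<longleftrightarrow> finite S \<and>
    (\<forall>c x y. (index c, x, y) \<in> S \<longrightarrow> step (\<lambda>n x y. (n, x, y) \<in> S) c x y)"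

definition derivable :: "nat \<Rightarrow> nat \<Rightarrow> nat \<Rightarrow> bool" where
  "derivable n x y \<longleftrightarrow> (\<exists>S. coherent S \<and> (n, x, y) \<in> S)"

lemma coherent_Union:
  assumes "finite F" "\<And>S. S \<in> F \<Longrightarrow> coherent S"
  shows "coherent (\<Union>F)"
  unfolding coherent_def
proof (intro conjI allI impI)
  show "finite (\<Union>F)"
    using assms by (auto simp: coherent_def)
  fix c x y assume "(index c, x, y) \<in> \<Union>F"
  then obtain S where "S \<in> F" "(index c, x, y) \<in> S"
    by blast
  then have "step (\<lambda>n x y. (n, x, y) \<in> S) c x y"
    using assms(2) by (simp add: coherent_def)
  then show "step (\<lambda>n x y. (n, x, y) \<in> \<Union>F) c x y"
    by (rule step_mono) (use \<open>S \<in> F\<close> in blast)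
qed

lemma coherent_finite_derivable:
  assumes "finite A" "\<And>n x y. (n, x, y) \<in> A \<Longrightarrow> derivable n x y"
  obtains S where "coherent S" "A \<subseteq> S"
proof -
  have "\<forall>t\<in>A. \<exists>S. coherent S \<and> t \<in> S"
    using assms(2) unfolding derivable_def by auto
  then obtain f where "\<And>t. t \<in> A \<Longrightarrow> coherent (f t) \<and> t \<in> f t"
    by metis
  then show ?thesis
    using that[of "\<Union>(f ` A)"] coherent_Union[of "f ` A"] assms(1) by blast
qed

text \<open>Even \<open>Mu\<close> has only finitely many premises, one for each number up to its
  result. Hence the finite sets deriving the premises can be merged into one.\<close>

lemma step_finite:
  assumes "step T c x y"
  obtains A where "finite A" "\<And>n x y. (n, x, y) \<in> A \<Longrightarrow> T n x y" "step (\<lambda>n x y. (n, x, y) \<in> A) c x y"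
proof (cases c)
  case (Pair f g)
  then obtain p q where "T (index f) x p" "T (index g) x q" "y = prod_encode (p, q)"
    using assms by auto
  then show ?thesis
    using that[of "{(index f, x, p), (index g, x, q)}"] Pair by auto
next
  case (Comp f g)
  then obtain q where "T (index g) x q" "T (index f) q y"
    using assms by auto
  then show ?thesis
    using that[of "{(index g, x, q), (index f, q, y)}"] Comp by auto
next
  case (Prec f g)
  show ?thesis
  proof (cases "dsnd x = 0")
    case True
    then show ?thesis
      using that[of "{(index f, dfst x, y)}"] Prec assms by auto
  next
    case False
    then obtain v where "T (index (Prec f g)) (prod_encode (dfst x, dsnd x - 1)) v"
      "T (index g) (prod_encode (dfst x, prod_encode (dsnd x - 1, v))) y"
      using assms Prec by (auto simp del: index.simps)
    then show ?thesis
      using that[of "{(index (Prec f g), prod_encode (dfst x, dsnd x - 1), v),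
          (index g, prod_encode (dfst x, prod_encode (dsnd x - 1, v)), y)}"] Prec False by auto
  qed
next
  case (Mu f)
  then obtain v where v: "\<And>m. m < y \<Longrightarrow> T (index f) (prod_encode (x, m)) (Suc (v m))"
    using assms by (auto simp del: index.simps) metis
  let ?A = "insert (index f, prod_encode (x, y), 0)
    ((\<lambda>m. (index f, prod_encode (x, m), Suc (v m))) ` {..<y})"
  show ?thesis
    by (rule that[of ?A]) (use v assms Mu in auto)
qed (use assms that[of "{}"] in auto)

lemma derivable_step:
  assumes "step derivable c x y"
  shows "derivable (index c) x y"
proof -
  obtain A where A: "finite A" "\<And>n x y. (n, x, y) \<in> A \<Longrightarrow> derivable n x y"
    "step (\<lambda>n x y. (n, x, y) \<in> A) c x y"
    using step_finite[OF assms] by metis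
  obtain S where S: "coherent S" "A \<subseteq> S"
    using coherent_finite_derivable[OF A(1,2)] by metis
  let ?S = "insert (index c, x, y) S"
  have "step (\<lambda>n x y. (n, x, y) \<in> ?S) d u v" if "(index d, u, v) \<in> ?S" for d u v
  proof (cases "(index d, u, v) \<in> S")
    case True
    then have "step (\<lambda>n x y. (n, x, y) \<in> S) d u v"
      using S(1) by (simp add: coherent_def)
    then show ?thesis
      by (rule step_mono) simp
  next
    case False
    then have "d = c" "u = x" "v = y"
      using that by (auto simp: inj_eq[OF inj_index])
    then show ?thesis
      using A(3) S(2) by (auto intro: step_mono)
  qed
  then have "coherent ?S"
    using S(1) by (simp add: coherent_def)
  then show ?thesis
    unfolding derivable_def by blast
qed

text \<open>Every clause of \<open>eval\<close> is an instance of \<open>step\<close>, under which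
  \<open>derivable\<close> is closed by \<open>derivable_step\<close>; the induction descends as in
  \<open>step_sound\<close>.\<close>

lemma derivable_eval: "eval c x = Some y \<Longrightarrow> derivable (index c) x y"
proof (induction c arbitrary: x y)
  case (Pair f g)
  then show ?case
    by (intro derivable_step) (auto simp del: index.simps simp: bind_eq_Some_conv)
next
  case (Comp f g)
  then obtain q where "eval g x = Some q" "eval f q = Some y"
    by (auto simp: bind_eq_Some_conv)
  then show ?case
    using Comp.IH by (intro derivable_step) (simp del: index.simps, blast)
next
  case (Prec f g)
  show ?case
    using Prec.prems
  proof (induction "dsnd x" arbitrary: x y)
    case 0
    then show ?case
      using Prec.IH(1) by (intro derivable_step) (simp add: eval_Prec_0 del: index.simps eval.simps)
  next
    case (Suc k)
    then obtain v where v: "eval (Prec f g) (prod_encode (dfst x, dsnd x - 1)) = Some v"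
      "eval g (prod_encode (dfst x, prod_encode (dsnd x - 1, v))) = Some y"
      by (auto simp: eval_Prec_Suc bind_eq_Some_conv simp del: index.simps eval.simps)
    have "derivable (index (Prec f g)) (prod_encode (dfst x, dsnd x - 1)) v"
      by (rule Suc.hyps(1)[OF _ v(1)]) (simp flip: Suc.hyps(2))
    moreover have "0 < dsnd x"
      by (simp flip: Suc.hyps(2))
    ultimately show ?case
      using Prec.IH(2)[OF v(2)] by (intro derivable_step) (simp del: index.simps, blast)
  qed
next
  case (Mu f)
  then obtain n where n: "eval f (prod_encode (x, n)) = Some 0"
    "\<forall>m<n. \<exists>v. eval f (prod_encode (x, m)) = Some (Suc v)"
    "y = (LEAST n. eval f (prod_encode (x, n)) = Some 0)"
    by (auto split: if_splits)
  then have "y \<le> n" "eval f (prod_encode (x, y)) = Some 0"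
    by (auto intro: Least_le LeastI)
  then show ?case
    using n(2) Mu.IH by (intro derivable_step) (auto simp del: index.simps, meson less_le_trans)
qed (auto intro!: derivable_step simp del: index.simps)

section \<open>Traces coded by natural numbers\<close>

definition triple :: "nat \<Rightarrow> nat \<Rightarrow> nat \<Rightarrow> nat" where
  "triple n x y = prod_encode (n, prod_encode (x, y))"

definition in_trace :: "nat \<Rightarrow> nat \<Rightarrow> nat \<Rightarrow> nat \<Rightarrow> bool" where
  "in_trace w n x y \<longleftrightarrow> triple n x y \<in> set (list_decode w)"

text \<open>This is \<open>step (in_trace w)\<close> in arithmetic: the constants are those of
  \<open>index\<close>, and all quantifiers are bounded for the sake of decidability.\<close>

definition justified :: "nat \<Rightarrow> nat \<Rightarrow> nat \<Rightarrow> nat \<Rightarrow> bool" where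
  "justified w n x y \<longleftrightarrow>
    n = 0 \<and> y = 0 \<or> n = 1 \<and> y = Suc x \<or> n = 2 \<and> y = dfst x \<or> n = 3 \<and> y = dsnd x \<or>
    (\<exists>a<n. \<exists>b<n. n = 4 + 4 * prod_encode (a, b) \<and>
      (\<exists>p<w. \<exists>q<w. in_trace w a x p \<and> in_trace w b x q \<and> y = prod_encode (p, q))) \<or>
    (\<exists>a<n. \<exists>b<n. n = 5 + 4 * prod_encode (a, b) \<and>
      (\<exists>q<w. in_trace w b x q \<and> in_trace w a q y)) \<or>
    (\<exists>a<n. \<exists>b<n. n = 6 + 4 * prod_encode (a, b) \<and>
      (dsnd x = 0 \<and> in_trace w a (dfst x) y \<or>
       0 < dsnd x \<and> (\<exists>v<w. in_trace w n (prod_encode (dfst x, dsnd x - 1)) v \<and>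
         in_trace w b (prod_encode (dfst x, prod_encode (dsnd x - 1, v))) y))) \<or>
    (\<exists>a<n. n = 7 + 4 * a \<and> in_trace w a (prod_encode (x, y)) 0 \<and>
      (\<forall>m<y. \<exists>v<w. in_trace w a (prod_encode (x, m)) (Suc v)))"

definition trace :: "nat \<Rightarrow> bool" where
  "trace w \<longleftrightarrow> (\<forall>n<w. \<forall>x<w. \<forall>y<w. in_trace w n x y \<longrightarrow> justified w n x y)"

lemma in_trace_less:
  assumes "in_trace w n x y"
  shows "n < w" "x < w" "y < w"
  using mem_list_decode_less[OF assms[unfolded in_trace_def]]
    le_prod_encode_1[of n "prod_encode (x, y)"] le_prod_encode_2[of "prod_encode (x, y)" n]
    le_prod_encode_1[of x y] le_prod_encode_2[of y x]
  unfolding triple_def by linarith+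

lemma justified_index: "justified w (index c) x y \<longleftrightarrow> step (in_trace w) c x y"
proof -
  have neq: "(4 + 4 * a = 5 + 4 * b) = False" "(4 + 4 * a = 6 + 4 * b) = False"
    "(4 + 4 * a = 7 + 4 * b) = False" "(5 + 4 * a = 6 + 4 * b) = False"
    "(5 + 4 * a = 7 + 4 * b) = False" "(6 + 4 * a = 7 + 4 * b) = False"
    "(5 + 4 * a = 4 + 4 * b) = False" "(6 + 4 * a = 4 + 4 * b) = False"
    "(7 + 4 * a = 4 + 4 * b) = False" "(6 + 4 * a = 5 + 4 * b) = False"
    "(7 + 4 * a = 5 + 4 * b) = False" "(7 + 4 * a = 6 + 4 * b) = False" for a b :: nat
    by presburger+
  \<comment> \<open>Indices of subcodes are below the index, and values recorded in \<open>w\<close>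
    are below \<open>w\<close>, so the bounds lose nothing.\<close>
  have bound: "a < i + 4 * prod_encode (a, b)" "b < i + 4 * prod_encode (a, b)" if "0 < i" for a b i
    using le_prod_encode_1[of a b] le_prod_encode_2[of b a] that by linarith+
  have bex: "(\<exists>v<w. in_trace w n x v \<and> P v) \<longleftrightarrow> (\<exists>v. in_trace w n x v \<and> P v)"
    "(\<exists>v<w. in_trace w n x (Suc v)) \<longleftrightarrow> (\<exists>v. in_trace w n x (Suc v))" for n x P
    using in_trace_less(3) Suc_lessD by blast+
  have bex2: "(\<exists>v<w. \<exists>u<w. in_trace w n x v \<and> in_trace w m z u \<and> P v u) \<longleftrightarrow>
    (\<exists>v u. in_trace w n x v \<and> in_trace w m z u \<and> P v u)" for n x m z P
    using in_trace_less(3) by blast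
  show ?thesis
    by (cases c) (auto simp: justified_def neq bex bex2 bound simp del: One_nat_def)
qed

text \<open>Kleene's normal form with a decidable matrix. Forward, a finite coherent set is listed
  and coded; backward is \<open>step_sound\<close>.\<close>

lemma kleene1_iff_trace: "kleene1 n x = Some y \<longleftrightarrow> (\<exists>w. trace w \<and> in_trace w n x y)"
proof -
  obtain c where c: "n = index c"
    using surj_index by metis
  show ?thesis
    unfolding c kleene1_index
  proof
    assume "eval c x = Some y"
    then have "derivable (index c) x y"
      by (rule derivable_eval)
    then obtain S where S: "coherent S" "(index c, x, y) \<in> S"
      unfolding derivable_def by blast
    then obtain ts where ts: "set ts = S"
      using S(1) finite_list[of S] by (auto simp: coherent_def)
    define w where "w = list_encode (map (\<lambda>(n, x, y). triple n x y) ts)"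
    have "in_trace w n x y \<longleftrightarrow> (n, x, y) \<in> S" for n x y
      unfolding in_trace_def w_def by (force simp: ts triple_def)
    then have "in_trace w = (\<lambda>n x y. (n, x, y) \<in> S)"
      by blast
    then have "justified w n x y" if "in_trace w n x y" for n x y
      using that S(1) surj_index[of n] unfolding coherent_def by (metis justified_index)
    then have "trace w"
      by (simp add: trace_def)
    then show "\<exists>w. trace w \<and> in_trace w (index c) x y"
      using \<open>in_trace w = _\<close> S(2) by metis
  next
    assume "\<exists>w. trace w \<and> in_trace w (index c) x y"
    then obtain w where w: "trace w" "in_trace w (index c) x y"
      by blast
    have "step (in_trace w) d u v" if "in_trace w (index d) u v" for d u v
      using w(1) that in_trace_less[OF that] unfolding trace_def justified_index[symmetric] by blast
    from step_sound[of "in_trace w", OF this w(2)] show "eval c x = Some y"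
      by blast
  qed
qed

lemma decidable_in_trace [comp]:
  assumes "computable w" "computable n" "computable x" "computable y"
  shows "decidable (\<lambda>p. in_trace (w p) (n p) (x p) (y p))"
  unfolding in_trace_def triple_def by (intro assms comp)

lemma decidable_trace [comp]:
  assumes "computable f"
  shows "decidable (\<lambda>p. trace (f p))"
proof -
  have "decidable trace"
    unfolding trace_def justified_def by (intro comp)
  then show ?thesis
    using assms by (rule decidable_compose)
qed

section \<open>The lower bound\<close>

text \<open>For \<open>x\<close> in \<open>V\<close>, the programs \<open>F 0 x\<close> and
  \<open>F 1 x\<close> become related at \<open>osucc (rank x)\<close> and not before. At
  \<open>x = 0\<close>, of rank \<alpha>, this separates the two relations.\<close>

lemma sim_kleene1_strict:
  fixes \<alpha> :: "'b :: infinite ordinal"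
  assumes "computable_ordinal \<alpha>"
  shows "sim kleene1 \<alpha> \<noteq> sim kleene1 (osucc \<alpha>)"
proof -
  obtain r where r: "computable_rel r" "Well_order r" "\<alpha> = otype r"
    using assms by (rule computable_ordinalE)
  \<comment> \<open>\<open>Suc i\<close> stands for the element \<open>i\<close> of \<open>r\<close>, and \<open>0\<close> for an additional top element.\<close>
  define R where "R y x \<longleftrightarrow> 0 < y \<and>
    (x = 0 \<and> (y - 1, y - 1) \<in> r \<or> 0 < x \<and> (y - 1, x - 1) \<in> r \<and> y \<noteq> x)" for y x
  have "decidable (\<lambda>p. R (dfst p) (dsnd p))"
    unfolding R_def by (intro r(1) comp)
  then obtain h where h: "inj h" "\<And>b x y. kleene1 (h (prod_encode (b, x))) y =
      Some (if R y x then h (prod_encode (b, y)) else 0)"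
    by (rule recursion_theorem_rel) blast
  define F where "F b x = Elem (h (prod_encode (b, x)))" for b x
  define rank :: "nat \<Rightarrow> 'b ordinal"
    where "rank x = (if x = 0 then \<alpha> else oseg r (x - 1))" for x
  define V where "V = {x. x = 0 \<or> x - 1 \<in> Field r}"
  have app: "val kleene1 (App (F b x) (Elem y)) = (if R y x then val kleene1 (F b y) else Some 0)"
    for b x y
    by (simp add: F_def h(2))
  \<comment> \<open>Moves along \<open>R\<close> lower the rank, and by \<open>rank_R\<close> they
    reach every smaller rank; the first fact yields \<open>upper\<close>, the second
    \<open>lower\<close>.\<close>
  have R_rank: "y \<in> V \<and> rank y < rank x" if "R y x" for x y
  proof -
    have "y - 1 \<in> Field r"
      using that by (auto simp: R_def FieldI1)
    moreover have "oseg r (y - 1) < (oseg r (x - 1) :: 'b ordinal)" if "0 < x"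
      by (rule oseg_less[OF r(2)]) (use \<open>R y x\<close> that in \<open>auto simp: R_def\<close>)
    ultimately show ?thesis
      using that oseg_less_otype[OF r(2), of "y - 1"] by (auto simp: R_def V_def rank_def r(3))
  qed
  have rank_R: "\<exists>y. R y x \<and> y \<in> V \<and> \<gamma> = rank y" if "\<gamma> < rank x" "x \<in> V" for x \<gamma>
  proof -
    have rank_le: "rank x \<le> otype r"
      using that(2) less_imp_le[OF oseg_less_otype[OF r(2), of "x - 1"]]
      by (auto simp: rank_def V_def r(3))
    obtain i where i: "i \<in> Field r" "\<gamma> = oseg r i"
      using oseg_cases[OF r(2) less_le_trans[OF \<open>\<gamma> < rank x\<close> rank_le]] by blast
    have "R (Suc i) x"
    proof (cases "x = 0")
      case True
      have "(i, i) \<in> r"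
        using i(1) r(2) by (auto simp: order_on_defs refl_on_def)
      then show ?thesis
        by (simp add: R_def True)
    next
      case False
      then show ?thesis
        using that i oseg_less_iff[OF r(2), of "x - 1" i] by (auto simp: R_def rank_def V_def)
    qed
    then show ?thesis
      using i by (intro exI[of _ "Suc i"]) (simp add: V_def rank_def)
  qed
  have upper: "sim kleene1 (osucc (rank x)) (F 0 x) (F 1 x)" for x
  proof (induction "rank x" arbitrary: x rule: less_induct)
    case less
    show ?case
      unfolding sim_osucc
    proof
      fix y
      show "sim kleene1 (rank x) (App (F 0 x) (Elem y)) (App (F 1 x) (Elem y))"
      proof (cases "R y x")
        case True
        then have y: "rank y < rank x"
          using R_rank by blast
        have "sim kleene1 (rank x) (F 0 y) (F 1 y)"
          by (rule sim_mono[OF less[OF y] osucc_le[OF y]])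
        then show ?thesis
          by (rule sim_val_cong) (simp_all only: app True if_True)
      next
        case False
        then have "kleene_eq kleene1 (App (F 0 x) (Elem y)) (App (F 1 x) (Elem y))"
          unfolding kleene_eq_def app by simp
        then show ?thesis
          by (rule sim_mono[OF sim_zeroI ozero_le])
      qed
    qed
  qed
  have lower: "rank x < \<beta>" if "sim kleene1 \<beta> (F 0 x) (F 1 x)" "x \<in> V" for \<beta> x
    using that
  proof (induction \<beta> arbitrary: x rule: less_induct)
    case (less \<beta>)
    show ?case
    proof (cases \<beta> rule: ordinal_zero_succ_limit)
      case 1
      then show ?thesis
        \<comment> \<open>Distinct tags give distinct elements, so the pair is unequal at stage
          0.\<close>
        using less.prems(1) inj_eq[OF h(1)] by (simp add: sim_ozero kleene_eq_def F_def)
    next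
      case (2 \<gamma>)
      show ?thesis
      proof (rule ccontr)
        assume "\<not> rank x < \<beta>"
        then have "\<gamma> < rank x"
          unfolding 2 less_osucc_iff by simp
        \<comment> \<open>Take a move to rank exactly \<gamma>: relatedness at \<gamma> would force
          \<open>rank y < \<gamma>\<close>.\<close>
        then obtain y where y: "R y x" "y \<in> V" "\<gamma> = rank y"
          using rank_R less.prems(2) by blast
        have "sim kleene1 \<gamma> (App (F 0 x) (Elem y)) (App (F 1 x) (Elem y))"
          using less.prems(1) unfolding 2 sim_osucc by blast
        then have "sim kleene1 \<gamma> (F 0 y) (F 1 y)"
          by (rule sim_val_cong) (simp_all only: app y(1) if_True)
        then have "rank y < \<gamma>"
          using less.IH[of \<gamma> y] y(2) 2 less_osucc by blast
        then show False
          using y(3) by simp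
      qed
    next
      case 3
      then obtain \<gamma> where "\<gamma> < \<beta>" "sim kleene1 \<gamma> (F 0 x) (F 1 x)"
        using less.prems(1) sim_limit by blast
      then show ?thesis
        using less.IH less.prems(2) by (meson less_trans)
    qed
  qed
  have "rank 0 = \<alpha>" "0 \<in> V"
    by (simp_all add: rank_def V_def)
  then have "sim kleene1 (osucc \<alpha>) (F 0 0) (F 1 0)" "\<not> sim kleene1 \<alpha> (F 0 0) (F 1 0)"
    using upper[of 0] lower[of \<alpha> 0] by auto
  then show ?thesis
    by metis
qed

section \<open>The upper bound\<close>

text \<open>
  \<open>0\<close> stands for the undefined value and \<open>Suc n\<close> for the value \<open>n\<close>. That \<open>u'\<close> is the result
  of applying \<open>u\<close> to \<open>x\<close> becomes a \<open>\<Pi>\<^sub>1\<close> condition in stages \<open>k\<close>, once a trace \<open>p\<close> witnessing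
  convergence is supplied.
\<close>

definition app_stage :: "nat \<Rightarrow> nat \<Rightarrow> nat \<Rightarrow> nat \<Rightarrow> nat \<Rightarrow> bool" where
  "app_stage u x u' p k \<longleftrightarrow>
    u = 0 \<and> u' = 0 \<or>
    0 < u \<and> 0 < u' \<and> trace p \<and> in_trace p (u - 1) x (u' - 1) \<or>
    0 < u \<and> u' = 0 \<and> (trace k \<longrightarrow> (\<forall>y<k. \<not> in_trace k (u - 1) x y))"

definition option_code :: "nat option \<Rightarrow> nat" where
  "option_code u = (case u of None \<Rightarrow> 0 | Some n \<Rightarrow> Suc n)"

lemma option_code_simps: "option_code None = 0" "option_code (Some n) = Suc n"
  by (simp_all add: option_code_def)

lemma option_code_inject: "option_code u = option_code v \<longleftrightarrow> u = v"
  by (simp add: option_code_def split: option.split)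

lemma app_stage_sound:
  assumes "\<And>k. app_stage (option_code u) x u' p k"
  shows "u' = option_code (Option.bind u (\<lambda>n. kleene1 n x))"
proof (cases u)
  case None
  then show ?thesis
    using assms[of 0] by (simp add: app_stage_def option_code_simps)
next
  case (Some n)
  show ?thesis
  proof (cases u')
    case 0
    \<comment> \<open>A value recorded in \<open>k\<close> is below \<open>k\<close>, so the bound
      on \<open>y\<close> in \<open>app_stage\<close> costs nothing.\<close>
    then have "\<not> in_trace k n x y" if "trace k" for k y
      using assms[of k] that in_trace_less(3)[of k n x y] Some
      by (auto simp: app_stage_def option_code_simps)
    then have "kleene1 n x = None"
      using kleene1_iff_trace by (metis option.exhaust)
    then show ?thesis
      by (simp add: 0 Some option_code_simps)
  next
    case (Suc y)
    then have "trace p" "in_trace p n x y"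
      using assms[of 0] Some by (auto simp: app_stage_def option_code_simps)
    then have "kleene1 n x = Some y"
      using kleene1_iff_trace by blast
    then show ?thesis
      by (simp add: Suc Some option_code_simps)
  qed
qed

lemma app_stage_complete:
  "\<exists>p. \<forall>k. app_stage (option_code u) x (option_code (Option.bind u (\<lambda>n. kleene1 n x))) p k"
proof (cases u)
  case None
  then show ?thesis
    by (simp add: app_stage_def option_code_simps)
next
  case (Some n)
  show ?thesis
  proof (cases "kleene1 n x")
    case None
    then have "\<not> in_trace k n x y" if "trace k" for k y
      using that kleene1_iff_trace[of n x y] by auto
    then show ?thesis
      by (auto simp: app_stage_def option_code_simps Some None)
  next
    case (Some y)
    then obtain p where "trace p" "in_trace p n x y"
      using kleene1_iff_trace by blast
    then show ?thesis
      using \<open>u = Some n\<close> Some by (intro exI[of _ p]) (simp add: app_stage_def option_code_simps)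
  qed
qed

text \<open>In a state reached by a move, the third component holds the argument and a trace for
  each side. Keeping these in the state frees the edge relation from existential
  quantifiers.\<close>

definition state :: "nat option \<Rightarrow> nat option \<Rightarrow> nat \<Rightarrow> nat" where
  "state u v m = prod_encode (option_code u, prod_encode (option_code v, m))"

text \<open>The projections of \<open>b\<close> unpack argument and traces. The first conjunct makes
  pairs of equal values leaves, since those could be applied forever.\<close>

definition move_stage :: "nat \<Rightarrow> nat \<Rightarrow> nat \<Rightarrow> bool" where
  "move_stage a b k \<longleftrightarrow> dfst a \<noteq> dfst (dsnd a) \<and>
    app_stage (dfst a) (dfst (dsnd (dsnd b))) (dfst b) (dfst (dsnd (dsnd (dsnd b)))) k \<and>
    app_stage (dfst (dsnd a)) (dfst (dsnd (dsnd b))) (dfst (dsnd b)) (dsnd (dsnd (dsnd (dsnd b)))) k"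

lemma decidable_move_stage: "decidable (\<lambda>p. move_stage (dfst p) (dfst (dsnd p)) (dsnd (dsnd p)))"
  unfolding move_stage_def app_stage_def by (intro comp)

lemma val_App_Elem: "val ap (App s (Elem x)) = Option.bind (val ap s) (\<lambda>n. ap n x)"
  by (cases "val ap s") auto

lemma move_stage_sound:
  assumes "\<And>k. move_stage (state (val kleene1 s) (val kleene1 t) m) b k"
  obtains x m' where
    "b = state (val kleene1 (App s (Elem x))) (val kleene1 (App t (Elem x))) m'"
proof (rule that)
  let ?x = "dfst (dsnd (dsnd b))"
  have "dfst b = option_code (val kleene1 (App s (Elem ?x)))"
    unfolding val_App_Elem
    by (rule app_stage_sound[where p = "dfst (dsnd (dsnd (dsnd b)))"])
      (use assms in \<open>simp add: move_stage_def state_def\<close>)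
  moreover have "dfst (dsnd b) = option_code (val kleene1 (App t (Elem ?x)))"
    unfolding val_App_Elem
    by (rule app_stage_sound[where p = "dsnd (dsnd (dsnd (dsnd b)))"])
      (use assms in \<open>simp add: move_stage_def state_def\<close>)
  ultimately show "b = state (val kleene1 (App s (Elem ?x))) (val kleene1 (App t (Elem ?x)))
      (dsnd (dsnd b))"
    unfolding state_def by (metis prod.collapse prod_decode_inverse)
qed

lemma move_stage_complete:
  assumes "val kleene1 s \<noteq> val kleene1 t"
  obtains m' where "\<And>k. move_stage (state (val kleene1 s) (val kleene1 t) m)
    (state (val kleene1 (App s (Elem x))) (val kleene1 (App t (Elem x))) m') k"
proof -
  obtain p where p: "\<forall>k. app_stage (option_code (val kleene1 s)) x
      (option_code (val kleene1 (App s (Elem x)))) p k"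
    using app_stage_complete[of "val kleene1 s" x] unfolding val_App_Elem[symmetric] ..
  obtain q where q: "\<forall>k. app_stage (option_code (val kleene1 t)) x
      (option_code (val kleene1 (App t (Elem x)))) q k"
    using app_stage_complete[of "val kleene1 t" x] unfolding val_App_Elem[symmetric] ..
  show thesis
    by (rule that[of "prod_encode (x, prod_encode (p, q))"])
      (use p q assms in \<open>simp add: move_stage_def state_def option_code_inject\<close>)
qed

text \<open>Equal values admit no move, and a move from a pair related at a successor leads to one
  of the premises of the clause. The component \<open>m\<close> is arbitrary because moves change
  it.\<close>

lemma sim_imp_acc:
  fixes \<alpha> :: "'b :: infinite ordinal"
  assumes "sim kleene1 \<alpha> s t"
  shows "state (val kleene1 s) (val kleene1 t) m
    \<in> Wellfounded.acc {(b, a). \<forall>k. move_stage a b k}"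
  using assms
proof (induction arbitrary: m rule: sim.induct)
  case (sim_zeroI s t)
  then show ?case
    by - (rule acc.accI, simp add: move_stage_def state_def kleene_eq_def)
next
  case (sim_succI \<alpha> s t)
  show ?case
  proof (rule acc.accI)
    fix b assume "(b, state (val kleene1 s) (val kleene1 t) m) \<in> {(b, a). \<forall>k. move_stage a b k}"
    then obtain x m' where
      "b = state (val kleene1 (App s (Elem x))) (val kleene1 (App t (Elem x))) m'"
      using move_stage_sound by blast
    then show "b \<in> Wellfounded.acc {(b, a). \<forall>k. move_stage a b k}"
      using sim_succI.IH by blast
  qed
next
  case (sim_limitI \<alpha> \<beta> s t)
  show ?case
    by (rule sim_limitI.IH)
qed

text \<open>The well-order above the moves from the given pair bounds its rank: a pair represented
  at \<open>x\<close> is related at \<open>osucc (oseg r x)\<close>, by induction on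
  \<open>oseg r x\<close>.\<close>

lemma sim_kleene1_computable:
  fixes \<alpha> :: "'b :: infinite ordinal"
  assumes "sim kleene1 \<alpha> s t"
  obtains \<beta> :: "'b ordinal" where "computable_ordinal \<beta>" "sim kleene1 \<beta> s t"
proof -
  obtain r rep x0 where r: "computable_rel r" "Well_order r"
    and x0: "rep x0 (state (val kleene1 s) (val kleene1 t) 0)"
    and Field: "\<And>x a. rep x a \<Longrightarrow> x \<in> Field r"
    and move: "\<And>x a b. rep x a \<Longrightarrow> (\<And>k. move_stage a b k) \<Longrightarrow> \<exists>y. (y, x) \<in> r - Id \<and> rep y b"
    using computable_well_order_above_Pi1_relation[OF decidable_move_stage sim_imp_acc[OF assms, of 0]]
    by blast
  have "sim kleene1 (osucc (oseg r x) :: 'b ordinal) s t"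
    if "rep x (state (val kleene1 s) (val kleene1 t) m)" for x s t m
    using that
  proof (induction "oseg r x :: 'b ordinal" arbitrary: x s t m rule: less_induct)
    case less
    show ?case
      unfolding sim_osucc
    proof
      fix z
      show "sim kleene1 (oseg r x :: 'b ordinal) (App s (Elem z)) (App t (Elem z))"
      proof (cases "val kleene1 s = val kleene1 t")
        case True
        then have "kleene_eq kleene1 (App s (Elem z)) (App t (Elem z))"
          by (simp add: kleene_eq_def)
        then show ?thesis
          by (rule sim_mono[OF sim_zeroI ozero_le])
      next
        case False
        obtain m' where "\<And>k. move_stage (state (val kleene1 s) (val kleene1 t) m)
            (state (val kleene1 (App s (Elem z))) (val kleene1 (App t (Elem z))) m') k"
          using move_stage_complete[OF False] by blast
        \<comment> \<open>The resulting pair sits at a smaller \<open>y\<close>, and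
          \<open>osucc (oseg r y) \<le> oseg r x\<close>.\<close>
        from move[OF less.prems this] obtain y where y: "(y, x) \<in> r" "y \<noteq> x"
          "rep y (state (val kleene1 (App s (Elem z))) (val kleene1 (App t (Elem z))) m')"
          by blast
        have "oseg r y < (oseg r x :: 'b ordinal)"
          by (rule oseg_less[OF r(2) y(1,2)])
        from sim_mono[OF less.hyps[OF this y(3)] osucc_le[OF this]] show ?thesis .
      qed
    qed
  qed
  from this[OF x0] have "sim kleene1 (otype r :: 'b ordinal) s t"
    by (rule sim_mono) (rule osucc_le[OF oseg_less_otype[OF r(2) Field[OF x0]]])
  then show thesis
    using that computable_ordinal_otype[OF r] by blast
qed

theorem theorem5p5:
  shows "pca_ord kleene1 = (omega1_CK :: 'b :: infinite ordinal)"
  unfolding pca_ord_def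
proof (rule Least_equality)
  let ?o = "omega1_CK :: 'b ordinal"
  have "sim kleene1 ?o s t \<longleftrightarrow> sim kleene1 (osucc ?o) s t" for s t
  proof
    show "sim kleene1 ?o s t \<Longrightarrow> sim kleene1 (osucc ?o) s t"
      using sim_mono less_osucc less_imp_le by blast
    assume "sim kleene1 (osucc ?o) s t"
    \<comment> \<open>A pair related anywhere is already related at a computable ordinal, which lies
      below \<open>?o\<close>.\<close>
    then obtain \<beta> :: "'b ordinal" where "computable_ordinal \<beta>" "sim kleene1 \<beta> s t"
      by (rule sim_kleene1_computable)
    then show "sim kleene1 ?o s t"
      using computable_iff_less_omega1_CK sim_mono less_imp_le by blast
  qed
  then show "sim kleene1 ?o = sim kleene1 (osucc ?o)"
    by blast
  \<comment> \<open>Ordinals below \<open>?o\<close> are computable, and there the relations still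
    grow.\<close>
  show "?o \<le> \<alpha>" if "sim kleene1 \<alpha> = sim kleene1 (osucc \<alpha>)" for \<alpha> :: "'b ordinal"
    using that sim_kleene1_strict computable_iff_less_omega1_CK by (meson not_le)
qed

end
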